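(* Let $t>0$ and let $X$ and $\{X^n\}_{n\ge1}$ be real-valued adapted càdlàg processes on $[0,t]$ with jump measures $\mu,\mu_n$ and predictable compensators $\nu,\nu_n$, respectively, such that each $X^n-X$ admits quadratic variation and $$[X^n-X]_t\to0\quad\text{a.s. as } n\to\infty.$$ Let $$\mathcal A:=\{(s,\omega): s\le t,\ \nu(\omega,\{s\},\mathbb R)>0\},\qquad \mathcal A_n:=\{(s,\omega): s\le t,\ \nu_n(\omega,\{s\},\mathbb R)>0\},$$ and for $r>0$, $k\ge1$ let $L(r,k):=r\big(1-\frac{3}{2^{k+2}}\big)$. Then for every $r>0$ there exists a family of stopping times $\{\theta_{q,k,\ell,n}\}_{q,k,\ell,n\in\mathbb N}$, depending on $r$, with the following properties. (1) For all $q,k,\ell,n$, $$\{s\in\mathcal A_n\cap[0,\theta_{q,k,\ell,n}):\ |\Delta X^n_s|>L(r,k)\}=\{s\in\mathcal A\cap[0,\theta_{q,k,\ell,n}):\ |\Delta X_s|>L(r,k)\}\quad\text{a.s.}$$ (2) For every $\varepsilon>0$ there exists $k_0$ such that for all $k\ge k_0$ there exists $\ell_0=\ell_0(k,\varepsilon)$ such that for all $\ell\ge\ell_0$ there exists $q_0=q_0(\ell,\varepsilon)$ such that for all $q\ge q_0$, $$\sup_{n\ge\ell}\mathbb P(\theta_{q,k,\ell,n}\le t)<\varepsilon.$$ (3) For all $q,k,\ell$, $$\sum_{s\le t}\ \sup_{n\ge\ell}\ \big(1_{\{\cdot<\theta_{q,k,\ell,n}\}}\big)_{s-}\left(\int_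{|x|>L(r,k)}\nu_n(\{s\},dx)+\int_{|x|>L(r,k)}\nu(\{s\},dx)\right)<\infty\qquad\text{a.s.}$$
   Context: All processes are defined on a common filtered probability space $(\Omega,\mathcal F,\{\mathcal F_u\}_{u\ge0},\mathbb P)$ satisfying the usual hypotheses and are adapted to this filtration. Stopping times may take the value $\infty$. Quadratic variation: a càdlàg process $Y$ on $[0,t]$ admits quadratic variation if for every $u\le t$ the sums $\sum_i (Y_{u_i}-Y_{u_{i-1}})^2$ over partitions $0=u_0<\dots<u_N=u$ converge in probability as the mesh tends to $0$; the limit is denoted $[Y]_u$. Jumps: $\Delta X_s=X_s-X_{s-}$ (with $\Delta X_0=0$). The jump measure of $X$ is $\mu(ds,dx)=\sum_{u\le t}1_{\{\Delta X_u\neq0\}}\delta_{(u,\Delta X_u)}(ds,dx)$, and $\nu$ denotes its predictable compensator (dual predictable projection). One works with a version of $\nu$ such that $\nu(\{s\},\mathbb R)\le1$ for all $s\le t$ and such that $\mathcal A$ is a thin set exhausted by a sequence of predictable stopping times; similarly for $\mu_n,\nu_n,\mathcal A_n$ and $X^n$. In (1), for given $\omega$, "$s\in\mathcal A\cap[0,\theta)$" means $(s,\omega)\in\mathcal A$ and $s<\theta(\omega)$, so the identity is between random subsets of $[0,t]$. In (3), $\big(1_{\{\cdot<\theta\}}\big)_{s-}$ is the left limit at time $s$ of the process $u\mapsto 1_{\{u<\theta\}}$ (so for $s>0$ it equals $1_{\{s\le\theta\}}$), and the sum runs over the (countably many) times $s\in(0,t]$ at which the summand is nonzero. *)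

theory Defs
  imports "HOL-Probability.Probability"
begin

text \<open>
  The filtration is indexed by \<^typ>\<open>ennreal\<close>, so that the library notions \<^locale>\<open>filtration\<close> and
  \<^const>\<open>stopping_time\<close> apply to stopping times that may take the value \<^term>\<open>\<infinity> :: ennreal\<close>.
  The sigma-algebra \<open>F \<infinity>\<close> is irrelevant: a filtration indexed by \<open>[0,\<infinity>)\<close> can always be extended by
  \<open>F \<infinity> = M\<close>, and the stopping time condition at \<open>\<infinity>\<close> is trivial.
\<close>

locale usual_filtered_prob_space =
  prob_space M + complete_measure M + filtration "space M" F
  for M :: "'a measure" and F :: "ennreal \<Rightarrow> 'a measure" +
  assumes subalgebra_F: "\<And>u. subalgebra M (F u)"
    and null_sets_F0: "null_sets M \<subseteq> sets (F 0)"
    and right_continuous_F: "\<And>u. u < \<infinity> \<Longrightarrow> sets (F u) = (\<Inter>v\<in>{u<..<\<infinity>}. sets (F v))"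

text \<open>
  Processes on \<open>[0,t]\<close> are functions of type \<^typ>\<open>real \<Rightarrow> 'a \<Rightarrow> real\<close>; values at times outside
  \<open>[0,t]\<close> never matter.
\<close>

definition adapted_on :: "(ennreal \<Rightarrow> 'a measure) \<Rightarrow> real \<Rightarrow> (real \<Rightarrow> 'a \<Rightarrow> real) \<Rightarrow> bool" where
  "adapted_on F t X \<longleftrightarrow> (\<forall>s\<in>{0..t}. X s \<in> borel_measurable (F (ennreal s)))"

definition cadlag_on :: "real \<Rightarrow> (real \<Rightarrow> real) \<Rightarrow> bool" where
  "cadlag_on t x \<longleftrightarrow>
     (\<forall>s\<in>{0..<t}. (x \<longlongrightarrow> x s) (at_right s)) \<and>
     (\<forall>s\<in>{0<..t}. \<exists>l. (x \<longlongrightarrow> l) (at_left s))"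

definition adapted_cadlag ::
    "'a measure \<Rightarrow> (ennreal \<Rightarrow> 'a measure) \<Rightarrow> real \<Rightarrow> (real \<Rightarrow> 'a \<Rightarrow> real) \<Rightarrow> bool" where
  "adapted_cadlag M F t X \<longleftrightarrow> adapted_on F t X \<and> (\<forall>\<omega>\<in>space M. cadlag_on t (\<lambda>s. X s \<omega>))"

definition left_lim :: "(real \<Rightarrow> real) \<Rightarrow> real \<Rightarrow> real" where
  "left_lim x s = Lim (at_left s) x"

definition jump :: "(real \<Rightarrow> 'a \<Rightarrow> real) \<Rightarrow> real \<Rightarrow> 'a \<Rightarrow> real" where
  "jump X s \<omega> = (if s \<le> 0 then 0 else X s \<omega> - left_lim (\<lambda>u. X u \<omega>) s)"

definition is_partition :: "real \<Rightarrow> nat \<Rightarrow> (nat \<Rightarrow> real) \<Rightarrow> bool" where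
  "is_partition u N p \<longleftrightarrow> p 0 = 0 \<and> p N = u \<and> (\<forall>i<N. p i < p (Suc i))"

text \<open>
  \<open>Q\<close> is (a version of) the quadratic variation \<open>[Y]\<close> of \<open>Y\<close> on \<open>[0,t]\<close>; each \<open>Q u\<close> is determined
  up to a null set.
\<close>

definition has_quadratic_variation ::
    "'a measure \<Rightarrow> real \<Rightarrow> (real \<Rightarrow> 'a \<Rightarrow> real) \<Rightarrow> (real \<Rightarrow> 'a \<Rightarrow> real) \<Rightarrow> bool" where
  "has_quadratic_variation M t Y Q \<longleftrightarrow>
     (\<forall>u\<in>{0..t}. Q u \<in> borel_measurable M \<and>
        (\<forall>\<epsilon>>0. \<forall>\<eta>>0. \<exists>\<delta>>0. \<forall>N p.
           is_partition u N p \<and> (\<forall>i<N. p (Suc i) - p i < \<delta>) \<longrightarrow>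
           measure M {\<omega> \<in> space M.
             \<bar>(\<Sum>i<N. (Y (p (Suc i)) \<omega> - Y (p i) \<omega>)\<^sup>2) - Q u \<omega>\<bar> > \<epsilon>} < \<eta>))"

definition predictable_sigma ::
    "'a measure \<Rightarrow> (ennreal \<Rightarrow> 'a measure) \<Rightarrow> (real \<times> 'a) measure" where
  "predictable_sigma M F = sigma ({0..} \<times> space M)
     ({{0} \<times> A | A. A \<in> sets (F 0)} \<union>
      {{s<..u} \<times> A | s u A. 0 \<le> s \<and> s \<le> u \<and> A \<in> sets (F (ennreal s))})"

definition predictable_sigma_on ::
    "'a measure \<Rightarrow> (ennreal \<Rightarrow> 'a measure) \<Rightarrow> real \<Rightarrow> (real \<times> 'a) measure" where
  "predictable_sigma_on M F t = restrict_space (predictable_sigma M F) ({0..t} \<times> space M)"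

definition predictable_stopping_time ::
    "'a measure \<Rightarrow> (ennreal \<Rightarrow> 'a measure) \<Rightarrow> ('a \<Rightarrow> ennreal) \<Rightarrow> bool" where
  "predictable_stopping_time M F T \<longleftrightarrow>
     stopping_time F T \<and>
     {(s, \<omega>). 0 \<le> s \<and> \<omega> \<in> space M \<and> ennreal s < T \<omega>} \<in> sets (predictable_sigma M F)"

definition stopping_time_graph :: "'a measure \<Rightarrow> ('a \<Rightarrow> ennreal) \<Rightarrow> (real \<times> 'a) set" where
  "stopping_time_graph M T = {(s, \<omega>). 0 \<le> s \<and> \<omega> \<in> space M \<and> T \<omega> = ennreal s}"

definition thin_exhausted_by_predictable ::
    "'a measure \<Rightarrow> (ennreal \<Rightarrow> 'a measure) \<Rightarrow> (real \<times> 'a) set \<Rightarrow> bool" where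
  "thin_exhausted_by_predictable M F D \<longleftrightarrow>
     (\<exists>T :: nat \<Rightarrow> 'a \<Rightarrow> ennreal.
        (\<forall>m. predictable_stopping_time M F (T m)) \<and>
        D = (\<Union>m. stopping_time_graph M (T m)) \<and>
        disjoint_family (\<lambda>m. stopping_time_graph M (T m)))"

text \<open>
  A random measure on \<open>[0,t] \<times> \<real>\<close> is a function \<open>\<nu> :: 'a \<Rightarrow> (real \<times> real) measure\<close> whose values are
  Borel measures on that space.
\<close>

definition jump_space :: "real \<Rightarrow> (real \<times> real) measure" where
  "jump_space t = restrict_space borel ({0..t} \<times> UNIV)"

text \<open>
  The sum of the Dirac masses at \<open>(u, \<Delta>X\<^sub>u)\<close> over the jump times \<open>u \<le> t\<close>, as the image of the counting
  measure on the jump times.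
\<close>

definition jump_measure :: "real \<Rightarrow> (real \<Rightarrow> 'a \<Rightarrow> real) \<Rightarrow> 'a \<Rightarrow> (real \<times> real) measure" where
  "jump_measure t X \<omega> =
     distr (count_space {u \<in> {0..t}. jump X u \<omega> \<noteq> 0}) (jump_space t) (\<lambda>u. (u, jump X u \<omega>))"

text \<open>
  \<open>\<nu>\<close> is the dual predictable projection of the random measure \<open>\<mu>\<close>: for every nonnegative predictable
  function \<open>W\<close> the integral process \<open>W * \<nu>\<close> is predictable, and \<open>W * \<nu>\<close> and \<open>W * \<mu>\<close> have the same
  expectation at the terminal time \<open>t\<close>.
\<close>

definition predictable_compensator ::
    "'a measure \<Rightarrow> (ennreal \<Rightarrow> 'a measure) \<Rightarrow> real \<Rightarrow>
     ('a \<Rightarrow> (real \<times> real) measure) \<Rightarrow> ('a \<Rightarrow> (real \<times> real) measure) \<Rightarrow> bool" where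
  "predictable_compensator M F t \<mu> \<nu> \<longleftrightarrow>
     (\<forall>\<omega>\<in>space M. sets (\<nu> \<omega>) = sets (jump_space t)) \<and>
     (\<forall>W :: (real \<times> 'a) \<times> real \<Rightarrow> ennreal.
        W \<in> borel_measurable (predictable_sigma_on M F t \<Otimes>\<^sub>M borel) \<longrightarrow>
          (\<lambda>(s, \<omega>). \<integral>\<^sup>+ (u, x). W ((u, \<omega>), x) * indicator {0..s} u \<partial>\<nu> \<omega>)
             \<in> borel_measurable (predictable_sigma_on M F t) \<and>
          (\<integral>\<^sup>+ \<omega>. (\<integral>\<^sup>+ (u, x). W ((u, \<omega>), x) \<partial>\<nu> \<omega>) \<partial>M) =
          (\<integral>\<^sup>+ \<omega>. (\<integral>\<^sup>+ (u, x). W ((u, \<omega>), x) \<partial>\<mu> \<omega>) \<partial>M))"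

definition atom_set :: "'a measure \<Rightarrow> real \<Rightarrow> ('a \<Rightarrow> (real \<times> real) measure) \<Rightarrow> (real \<times> 'a) set" where
  "atom_set M t \<nu> = {(s, \<omega>). s \<in> {0..t} \<and> \<omega> \<in> space M \<and> emeasure (\<nu> \<omega>) ({s} \<times> UNIV) > 0}"

text \<open>The standing choice of a good version of the compensator of the jump measure of \<open>X\<close>.\<close>

definition jump_compensator ::
    "'a measure \<Rightarrow> (ennreal \<Rightarrow> 'a measure) \<Rightarrow> real \<Rightarrow> (real \<Rightarrow> 'a \<Rightarrow> real) \<Rightarrow>
     ('a \<Rightarrow> (real \<times> real) measure) \<Rightarrow> bool" where
  "jump_compensator M F t X \<nu> \<longleftrightarrow>
     predictable_compensator M F t (jump_measure t X) \<nu> \<and>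
     (\<forall>\<omega>\<in>space M. \<forall>s\<in>{0..t}. emeasure (\<nu> \<omega>) ({s} \<times> UNIV) \<le> 1) \<and>
     thin_exhausted_by_predictable M F (atom_set M t \<nu>)"

definition threshold :: "real \<Rightarrow> nat \<Rightarrow> real" where
  "threshold r k = r * (1 - 3 / 2 ^ (k + 2))"

end

theory Submission
  imports Defs
begin

text \<open>
  The square of each jump of \<open>X\<^sup>n - X\<close> is at most \<open>[X\<^sup>n - X]\<^sub>t\<close>, so the jumps of \<open>X\<^sup>n\<close> converge to those
  of \<open>X\<close>, uniformly in time, almost surely. Put \<open>c = r / 2\<^sup>k\<^sup>+\<^sup>2\<close> and \<open>L = L(r,k)\<close>. The stopping time
  \<open>\<theta>\<close> is the infimum of the times at which a jump of some \<open>X\<^sup>n\<close> with \<open>n \<ge> l\<close> deviates from that of \<open>X\<close> by at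
  least \<open>c\<close>, or a jump of \<open>X\<close> has a size in \<open>[L - c, L + c]\<close>, or \<open>X\<close> makes its \<open>q\<close>-th jump of size at
  least \<open>L\<close>. For \<open>n \<ge> l\<close> it is the same for all \<open>n\<close>. It is a stopping time because whether a
  cadlag path has had a jump in a closed set \<open>K\<close> with \<open>0 \<notin> K\<close> is determined by countably many of its
  increments (\<open>path_jump_in_closed_iff\<close>) and the filtration is right-continuous
  (\<open>stopping_time_hitting_time\<close>).

  Before \<open>\<theta>\<close> a jump of \<open>X\<^sup>n\<close> exceeds \<open>L\<close> if and only if the jump of \<open>X\<close> does. Moreover a process
  almost surely has no jump at predictable times that its compensator does not charge
  (\<open>AE_no_jump_off_atoms\<close>), so that a common large jump at a time in \<open>\<A>\<close> or \<open>\<A>\<^sub>n\<close> lies in both of these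
  sets. This gives the equality of the two sets of jump times.

  The event \<open>\<theta> \<le> t\<close> is covered by three events. The windows \<open>[L - c, L + c]\<close> move up to \<open>r\<close> from below
  as \<open>k \<rightarrow> \<infinity>\<close>, and \<open>X\<close> has finitely many jumps of size at least \<open>r / 2\<close>; for fixed \<open>k\<close> the
  deviations fall below \<open>c\<close> as \<open>l \<rightarrow> \<infinity>\<close>; and the number of jumps of size at least \<open>L\<close> is finite, hence below \<open>q\<close> as
  \<open>q \<rightarrow> \<infinity>\<close>. Almost surely each event thus fails eventually, and its probability tends to zero.

  For the sum, all jumps larger than \<open>L\<close> of \<open>X\<close> and of the \<open>X\<^sup>n\<close> with \<open>n \<ge> l\<close> up to and including \<open>\<theta>\<close> sit
  on at most \<open>q\<close> common times. The supremum over the first \<open>m\<close> compensators is taken apart along the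
  predictable sets on which a given one of them has the largest atom. On such a set the expected sum
  of atoms is an expected number of jumps, so that the expected sum of the suprema is at most \<open>q\<close>,
  whatever \<open>m\<close> (\<open>AE_sum_SUP_atoms_finite\<close>).
\<close>

section \<open>Jumps of a cadlag path\<close>

definition path_jump :: "(real \<Rightarrow> real) \<Rightarrow> real \<Rightarrow> real" where
  "path_jump y s = (if s \<le> 0 then 0 else y s - left_lim y s)"

lemma jump_eq_path_jump: "jump X s \<omega> = path_jump (\<lambda>u. X u \<omega>) s"
  by (simp add: jump_def path_jump_def)

lemma cadlag_on_tendsto_left_lim:
  assumes "cadlag_on t y" "0 < s" "s \<le> t"
  shows "(y \<longlongrightarrow> left_lim y s) (at_left s)"
proof -
  obtain l where l: "(y \<longlongrightarrow> l) (at_left s)"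
    using assms unfolding cadlag_on_def by force
  then have "left_lim y s = l"
    unfolding left_lim_def by (intro tendsto_Lim) (simp_all add: trivial_limit_at_left_real)
  with l show ?thesis by simp
qed

lemma cadlag_on_diff:
  assumes "cadlag_on t x" "cadlag_on t y"
  shows "cadlag_on t (\<lambda>s. x s - y s)"
  using assms unfolding cadlag_on_def by (blast intro: tendsto_diff)

lemma path_jump_diff:
  assumes "cadlag_on t x" "cadlag_on t y" "s \<le> t"
  shows "path_jump (\<lambda>s. x s - y s) s = path_jump x s - path_jump y s"
proof (cases "s \<le> 0")
  case False
  then have "((\<lambda>s. x s - y s) \<longlongrightarrow> left_lim x s - left_lim y s) (at_left s)"
    using assms by (intro tendsto_diff cadlag_on_tendsto_left_lim) auto
  then have "left_lim (\<lambda>s. x s - y s) s = left_lim x s - left_lim y s"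
    unfolding left_lim_def by (intro tendsto_Lim) (simp_all add: trivial_limit_at_left_real)
  with False show ?thesis by (simp add: path_jump_def)
qed (simp add: path_jump_def)

text \<open>
  Close to a time \<open>s\<close> the path is nearly constant on either side of \<open>s\<close>, so an increment is either
  nearly zero or nearly the jump at \<open>s\<close>, according to whether it straddles \<open>s\<close>.
\<close>

lemma cadlag_on_increments_near:
  assumes y: "cadlag_on t y" and s: "0 \<le> s" "s \<le> t" and "\<eta> > 0"
  obtains \<delta> where "\<delta> > 0"
    "\<And>p q. \<lbrakk>0 \<le> p; p \<le> q; q \<le> t; \<bar>p - s\<bar> < \<delta>; \<bar>q - s\<bar> < \<delta>; p < s; s \<le> q\<rbrakk>
       \<Longrightarrow> \<bar>y q - y p - path_jump y s\<bar> < \<eta>"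
    "\<And>p q. \<lbrakk>0 \<le> p; p \<le> q; q \<le> t; \<bar>p - s\<bar> < \<delta>; \<bar>q - s\<bar> < \<delta>; \<not> (p < s \<and> s \<le> q)\<rbrakk>
       \<Longrightarrow> \<bar>y q - y p\<bar> < \<eta>"
proof -
  have "\<exists>d>0. \<forall>u. s \<le> u \<and> u \<le> t \<and> u < s + d \<longrightarrow> \<bar>y u - y s\<bar> < \<eta> / 2"
  proof (cases "s < t")
    case True
    then have "(y \<longlongrightarrow> y s) (at_right s)"
      using y s by (auto simp: cadlag_on_def)
    then have "eventually (\<lambda>u. dist (y u) (y s) < \<eta> / 2) (at_right s)"
      by (rule tendstoD) (use \<open>\<eta> > 0\<close> in simp)
    then obtain b where b: "b > s" "\<And>u. s < u \<Longrightarrow> u < b \<Longrightarrow> \<bar>y u - y s\<bar> < \<eta> / 2"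
      unfolding eventually_at_right_field dist_real_def by blast
    have "\<bar>y u - y s\<bar> < \<eta> / 2" if "s \<le> u" "u < b" for u
      using b(2)[of u] that \<open>\<eta> > 0\<close> by (cases "u = s") auto
    with b(1) show ?thesis
      by (intro exI[of _ "b - s"]) auto
  next
    case False
    with s \<open>\<eta> > 0\<close> show ?thesis by (intro exI[of _ 1]) auto
  qed
  then obtain d1 where d1: "d1 > 0"
    "\<And>u. s \<le> u \<Longrightarrow> u \<le> t \<Longrightarrow> u < s + d1 \<Longrightarrow> \<bar>y u - y s\<bar> < \<eta> / 2" by blast
  have "\<exists>d>0. \<forall>u. 0 \<le> u \<and> u < s \<and> s - d < u \<longrightarrow> \<bar>y u - left_lim y s\<bar> < \<eta> / 2"
  proof (cases "0 < s")
    case True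
    then have "(y \<longlongrightarrow> left_lim y s) (at_left s)"
      using y s by (intro cadlag_on_tendsto_left_lim)
    then have "eventually (\<lambda>u. dist (y u) (left_lim y s) < \<eta> / 2) (at_left s)"
      by (rule tendstoD) (use \<open>\<eta> > 0\<close> in simp)
    then obtain b where b: "b < s" "\<And>u. b < u \<Longrightarrow> u < s \<Longrightarrow> \<bar>y u - left_lim y s\<bar> < \<eta> / 2"
      unfolding eventually_at_left_field dist_real_def by blast
    show ?thesis
      using b by (intro exI[of _ "s - b"]) auto
  qed (auto intro!: exI[of _ 1])
  then obtain d2 where d2: "d2 > 0"
    "\<And>u. 0 \<le> u \<Longrightarrow> u < s \<Longrightarrow> s - d2 < u \<Longrightarrow> \<bar>y u - left_lim y s\<bar> < \<eta> / 2" by blast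
  show ?thesis
  proof (rule that[of "min d1 d2"])
    show "min d1 d2 > 0" using d1 d2 by simp
  next
    fix p q assume H: "0 \<le> p" "p \<le> q" "q \<le> t" "\<bar>p - s\<bar> < min d1 d2" "\<bar>q - s\<bar> < min d1 d2"
      "p < s" "s \<le> q"
    have "\<bar>y q - y s\<bar> < \<eta> / 2" by (rule d1(2)) (use H in auto)
    moreover have "\<bar>y p - left_lim y s\<bar> < \<eta> / 2" by (rule d2(2)) (use H in auto)
    moreover have "path_jump y s = y s - left_lim y s" using H by (simp add: path_jump_def)
    ultimately show "\<bar>y q - y p - path_jump y s\<bar> < \<eta>" by linarith
  next
    fix p q assume H: "0 \<le> p" "p \<le> q" "q \<le> t" "\<bar>p - s\<bar> < min d1 d2" "\<bar>q - s\<bar> < min d1 d2"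
      "\<not> (p < s \<and> s \<le> q)"
    then consider "s \<le> p" | "q < s" by linarith
    then show "\<bar>y q - y p\<bar> < \<eta>"
    proof cases
      case 1
      have "\<bar>y q - y s\<bar> < \<eta> / 2" by (rule d1(2)) (use 1 H in auto)
      moreover have "\<bar>y p - y s\<bar> < \<eta> / 2" by (rule d1(2)) (use 1 H in auto)
      ultimately show ?thesis by linarith
    next
      case 2
      have "\<bar>y q - left_lim y s\<bar> < \<eta> / 2" by (rule d2(2)) (use 2 H in auto)
      moreover have "\<bar>y p - left_lim y s\<bar> < \<eta> / 2" by (rule d2(2)) (use 2 H in auto)
      ultimately show ?thesis by linarith
    qed
  qed
qed

text \<open>
  Jumps of size at least \<open>a\<close> cannot accumulate: near an accumulation point \<open>s\<close>, no increment on one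
  side of \<open>s\<close> exceeds \<open>a / 2\<close>, and the jumps on that side are limits of such increments.
\<close>

lemma cadlag_on_finite_large_jumps:
  assumes y: "cadlag_on t y" and "a > 0"
  shows "finite {s \<in> {0<..t}. \<bar>path_jump y s\<bar> \<ge> a}" (is "finite ?J")
proof (rule ccontr)
  assume "infinite ?J"
  then obtain s where s: "s \<in> {0..t}" "s islimpt ?J"
    using Heine_Borel_imp_Bolzano_Weierstrass[of "{0..t}" ?J] by fastforce
  from s have "0 \<le> s" "s \<le> t" by auto
  then obtain d where d: "d > 0"
    "\<And>p q. \<lbrakk>0 \<le> p; p \<le> q; q \<le> t; \<bar>p - s\<bar> < d; \<bar>q - s\<bar> < d; \<not> (p < s \<and> s \<le> q)\<rbrakk>
       \<Longrightarrow> \<bar>y q - y p\<bar> < a / 2"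
    by (rule cadlag_on_increments_near[OF y, of s "a / 2"]) (use \<open>a > 0\<close> in auto)
  obtain v where v: "v \<in> ?J" "v \<noteq> s" "\<bar>v - s\<bar> < d"
    using s(2) d(1) by (auto simp: islimpt_approachable dist_real_def)
  then have "0 \<le> v" "v \<le> t" by auto
  then obtain d' where d': "d' > 0"
    "\<And>p q. \<lbrakk>0 \<le> p; p \<le> q; q \<le> t; \<bar>p - v\<bar> < d'; \<bar>q - v\<bar> < d'; p < v; v \<le> q\<rbrakk>
       \<Longrightarrow> \<bar>y q - y p - path_jump y v\<bar> < a / 2"
    by (rule cadlag_on_increments_near[OF y, of v "a / 2"]) (use \<open>a > 0\<close> in auto)
  define w where "w = (if v < s then max 0 (s - d) else max 0 s)"
  have "max w (v - d') < v" using v d' d by (auto simp: w_def)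
  then obtain p where p: "max w (v - d') < p" "p < v" using dense by blast
  have "\<bar>y v - y p\<bar> < a / 2"
    using p v d by (intro d(2)) (auto simp: w_def split: if_splits)
  moreover have "\<bar>y v - y p - path_jump y v\<bar> < a / 2"
    using p v by (intro d'(2)) (auto simp: w_def split: if_splits)
  ultimately have "\<bar>path_jump y v\<bar> < a" by linarith
  with v(1) show False by simp
qed

text \<open>
  Whether a jump lies in \<open>K\<close> can be read off countably many increments. Increments over shorter and
  shorter intervals that approach \<open>K\<close> have an accumulation point \<open>s\<close>; as \<open>0 \<notin> K\<close> and \<open>K\<close> is closed,
  they must straddle \<open>s\<close>, so that they converge to the jump at \<open>s\<close>.
\<close>

lemma path_jump_in_closed_iff:
  assumes y: "cadlag_on t y" and a: "0 \<le> a" "a < u" "u \<le> t"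
    and K: "closed K" "K \<noteq> {}" "0 \<notin> K"
  defines "D \<equiv> insert u (\<rat> \<inter> {a<..<u})"
  shows "(\<exists>s\<in>{a<..u}. path_jump y s \<in> K) \<longleftrightarrow>
    (\<forall>j. \<exists>p\<in>D. \<exists>q\<in>D. p < q \<and> q - p < 1 / real (Suc j) \<and> infdist (y q - y p) K < 1 / real (Suc j))"
    (is "?L \<longleftrightarrow> (\<forall>j. ?R j)")
proof
  assume ?L
  then obtain s where s: "a < s" "s \<le> u" "path_jump y s \<in> K" by auto
  show "\<forall>j. ?R j"
  proof
    fix j
    define \<eta> where "\<eta> = 1 / real (Suc j)"
    have \<eta>: "\<eta> > 0" by (simp add: \<eta>_def)
    obtain d where d: "d > 0"
      "\<And>p q. \<lbrakk>0 \<le> p; p \<le> q; q \<le> t; \<bar>p - s\<bar> < d; \<bar>q - s\<bar> < d; p < s; s \<le> q\<rbrakk>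
       \<Longrightarrow> \<bar>y q - y p - path_jump y s\<bar> < \<eta>"
      by (rule cadlag_on_increments_near[OF y, of s \<eta>]) (use s a \<eta> in auto)
    define e where "e = min d (\<eta> / 2)"
    have e: "e > 0" "e \<le> d" "e \<le> \<eta> / 2" using d \<eta> by (auto simp: e_def)
    have "max a (s - e) < s" using s e by auto
    then obtain p where p: "p \<in> \<rat>" "max a (s - e) < p" "p < s" using Rats_dense_in_real by blast
    have "\<exists>q\<in>D. s \<le> q \<and> q < s + e \<and> q \<le> u"
    proof (cases "s = u")
      case True
      then show ?thesis using e by (auto simp: D_def)
    next
      case False
      then have "s < min u (s + e)" using s e by auto
      then obtain q where "q \<in> \<rat>" "s < q" "q < min u (s + e)" using Rats_dense_in_real by blast
      then show ?thesis using s by (intro bexI[of _ q]) (auto simp: D_def)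
    qed
    then obtain q where q: "q \<in> D" "s \<le> q" "q < s + e" "q \<le> u" by blast
    have "p \<in> D" using p s by (auto simp: D_def)
    have "\<bar>y q - y p - path_jump y s\<bar> < \<eta>"
      using p q a s e by (intro d) auto
    moreover have "infdist (y q - y p) K \<le> dist (y q - y p) (path_jump y s)"
      using s by (intro infdist_le)
    ultimately have "infdist (y q - y p) K < \<eta>" by (auto simp: dist_real_def)
    then show "?R j"
      using \<open>p \<in> D\<close> q p e unfolding \<eta>_def[symmetric] by (intro bexI[of _ p] bexI[of _ q]) auto
  qed
next
  assume R: "\<forall>j. ?R j"
  then obtain p q where pq: "\<And>j. p j \<in> D" "\<And>j. q j \<in> D" "\<And>j. p j < q j"
    "\<And>j. q j - p j < 1 / real (Suc j)" "\<And>j. infdist (y (q j) - y (p j)) K < 1 / real (Suc j)"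
    by metis
  have D: "D \<subseteq> {a<..u}" using a by (auto simp: D_def)
  have "\<forall>j. p j \<in> {a..u}" using pq(1) D by (auto simp: subset_eq less_imp_le)
  then obtain s r where sr: "s \<in> {a..u}" "strict_mono r" "(p \<circ> r) \<longlonglongrightarrow> s"
    using compact_Icc[of a u] unfolding compact_def by metis
  have inv0: "(\<lambda>j. 1 / real (Suc j)) \<longlonglongrightarrow> 0"
    using LIMSEQ_inverse_real_of_nat by (simp add: divide_inverse)
  have inv: "(\<lambda>j. 1 / real (Suc (r j))) \<longlonglongrightarrow> 0"
    using LIMSEQ_subseq_LIMSEQ[OF inv0 sr(2)] by (simp add: o_def)
  have diff0: "(\<lambda>j. q (r j) - p (r j)) \<longlonglongrightarrow> 0"
    by (rule tendsto_sandwich[OF _ _ tendsto_const inv])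
      (use pq(3,4) in \<open>auto intro!: always_eventually less_imp_le\<close>)
  then have qs: "(\<lambda>j. q (r j)) \<longlonglongrightarrow> s"
    using tendsto_add[OF diff0 sr(3)[unfolded o_def]] by simp
  define e where "e = infdist 0 K"
  have e: "e > 0" using K unfolding e_def
    by (metis infdist_nonneg in_closed_iff_infdist_zero order_le_less)
  have key: "s \<in> {a<..u} \<and> infdist (path_jump y s) K < 2 * \<eta>" if \<eta>: "0 < \<eta>" "\<eta> \<le> e / 2" for \<eta>
  proof -
    obtain d where d: "d > 0"
      "\<And>p q. \<lbrakk>0 \<le> p; p \<le> q; q \<le> t; \<bar>p - s\<bar> < d; \<bar>q - s\<bar> < d; p < s; s \<le> q\<rbrakk>
         \<Longrightarrow> \<bar>y q - y p - path_jump y s\<bar> < \<eta>"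
      "\<And>p q. \<lbrakk>0 \<le> p; p \<le> q; q \<le> t; \<bar>p - s\<bar> < d; \<bar>q - s\<bar> < d; \<not> (p < s \<and> s \<le> q)\<rbrakk>
         \<Longrightarrow> \<bar>y q - y p\<bar> < \<eta>"
      by (rule cadlag_on_increments_near[OF y, of s \<eta>]) (use sr(1) a \<eta> in auto)
    have "eventually (\<lambda>j. dist (p (r j)) s < d) sequentially"
      using sr(3) d(1) by (auto simp: o_def dest: tendstoD)
    moreover have "eventually (\<lambda>j. dist (q (r j)) s < d) sequentially"
      using qs d(1) by (auto dest: tendstoD)
    moreover have "eventually (\<lambda>j. 1 / real (Suc (r j)) < \<eta>) sequentially"
      using order_tendstoD(2)[OF inv \<eta>(1)] .
    ultimately have "eventually (\<lambda>j. dist (p (r j)) s < d \<and> dist (q (r j)) s < d \<and> 1 / real (Suc (r j)) < \<eta>) sequentially"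
      by eventually_elim auto
    then obtain j where j: "\<bar>p (r j) - s\<bar> < d" "\<bar>q (r j) - s\<bar> < d" "1 / real (Suc (r j)) < \<eta>"
      unfolding eventually_sequentially dist_real_def by blast
    let ?p = "p (r j)" and ?q = "q (r j)"
    have in_D: "a < ?p" "?p < ?q" "?q \<le> u" using pq(1)[of "r j"] pq(2)[of "r j"] pq(3)[of "r j"] D by auto
    have id: "infdist (y ?q - y ?p) K < \<eta>" using pq(5)[of "r j"] j(3) by linarith
    have str: "?p < s \<and> s \<le> ?q"
    proof (rule ccontr)
      assume "\<not> ?thesis"
      then have "\<bar>y ?q - y ?p\<bar> < \<eta>" using j in_D a by (intro d(3)) auto
      moreover have "infdist 0 K \<le> infdist (y ?q - y ?p) K + dist 0 (y ?q - y ?p)"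
        by (rule infdist_triangle)
      ultimately show False using id \<eta> by (auto simp: e_def dist_real_def)
    qed
    then have "\<bar>y ?q - y ?p - path_jump y s\<bar> < \<eta>" using j in_D a by (intro d(2)) auto
    moreover have "infdist (path_jump y s) K \<le> infdist (y ?q - y ?p) K + dist (path_jump y s) (y ?q - y ?p)"
      by (rule infdist_triangle)
    ultimately have "infdist (path_jump y s) K < 2 * \<eta>"
      using id by (auto simp: dist_real_def)
    with str in_D show ?thesis by auto
  qed
  have "infdist (path_jump y s) K \<le> 0"
  proof (rule field_le_epsilon)
    fix z :: real assume "z > 0"
    then have "infdist (path_jump y s) K < 2 * min (e / 2) (z / 2)"
      using key[of "min (e / 2) (z / 2)"] e by simp
    then show "infdist (path_jump y s) K \<le> 0 + z" by linarith
  qed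
  then have "path_jump y s \<in> K"
    using K by (metis in_closed_iff_infdist_zero infdist_nonneg antisym)
  then show ?L using key[of "e / 2"] e by auto
qed

text \<open>
  A rational time \<open>p\<close> separates the last of the \<open>Suc j\<close> times from the earlier ones; this is the
  induction step that makes counting processes adapted.
\<close>

lemma Suc_le_card_Ioc_iff:
  fixes P :: "real \<Rightarrow> bool"
  assumes fin: "finite {s \<in> {0<..u}. P s}"
  shows "Suc j \<le> card {s \<in> {0<..u}. P s} \<longleftrightarrow>
    (\<exists>p \<in> \<rat> \<inter> {0..<u}. j \<le> card {s \<in> {0<..p}. P s} \<and> (\<exists>s\<in>{p<..u}. P s))"
proof
  let ?S = "{s \<in> {0<..u}. P s}"
  assume S: "Suc j \<le> card ?S"
  then have "?S \<noteq> {}" by (metis card.empty not_less_eq_eq le0)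
  define m where "m = Max ?S"
  have m: "m \<in> ?S" unfolding m_def using fin \<open>?S \<noteq> {}\<close> by (rule Max_in)
  define m' where "m' = Max (insert 0 (?S - {m}))"
  have "m' \<in> insert 0 (?S - {m})" unfolding m'_def using fin by (intro Max_in) auto
  then have "m' < m" using m fin Max_ge[OF fin, folded m_def, of m'] by auto
  then obtain p where p: "p \<in> \<rat>" "m' < p" "p < m" using Rats_dense_in_real by blast
  have le: "v \<le> m'" if "v \<in> insert 0 (?S - {m})" for v
    unfolding m'_def using that fin by (intro Max_ge) auto
  have "?S - {m} \<subseteq> {s \<in> {0<..p}. P s}" using le p by force
  moreover have "finite {s \<in> {0<..p}. P s}"
    using fin by (rule finite_subset[rotated]) (use p m in auto)
  ultimately have "card (?S - {m}) \<le> card {s \<in> {0<..p}. P s}" by (rule card_mono[rotated])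
  then have "j \<le> card {s \<in> {0<..p}. P s}" using S m fin by (simp add: card_Diff_singleton)
  moreover have "0 \<le> p" using le[of 0] p by auto
  ultimately show "\<exists>p \<in> \<rat> \<inter> {0..<u}. j \<le> card {s \<in> {0<..p}. P s} \<and> (\<exists>s\<in>{p<..u}. P s)"
    using p m by (intro bexI[of _ p]) auto
next
  assume "\<exists>p \<in> \<rat> \<inter> {0..<u}. j \<le> card {s \<in> {0<..p}. P s} \<and> (\<exists>s\<in>{p<..u}. P s)"
  then obtain p v where p: "0 \<le> p" "p < u" "j \<le> card {s \<in> {0<..p}. P s}" "v \<in> {p<..u}" "P v"
    by auto
  have "finite {s \<in> {0<..p}. P s}"
    using fin by (rule finite_subset[rotated]) (use p in auto)
  then have "Suc j \<le> card (insert v {s \<in> {0<..p}. P s})"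
    using p by auto
  also have "\<dots> \<le> card {s \<in> {0<..u}. P s}"
    using fin p by (intro card_mono) auto
  finally show "Suc j \<le> card {s \<in> {0<..u}. P s}" .
qed

section \<open>Quadratic variation dominates the squared jumps\<close>

text \<open>
  On a fine uniform partition of \<open>[0,t]\<close> a single summand, the squared increment over the cell
  \<open>(p, q]\<close> that contains \<open>s\<close>, is already close to the squared jump at \<open>s\<close>.
\<close>

lemma jump_le_sqrt_sum_squared_increments:
  assumes y: "cadlag_on t y" and s: "0 < s" "s \<le> t" and \<eta>: "\<eta> > 0"
  shows "\<forall>\<^sub>F N in sequentially. \<bar>path_jump y s\<bar> - \<eta> \<le>
    sqrt (\<Sum>i<N. (y (t * real (Suc i) / real N) - y (t * real i / real N))\<^sup>2)"
proof -
  obtain d where d: "d > 0"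
    "\<And>p q. \<lbrakk>0 \<le> p; p \<le> q; q \<le> t; \<bar>p - s\<bar> < d; \<bar>q - s\<bar> < d; p < s; s \<le> q\<rbrakk>
       \<Longrightarrow> \<bar>y q - y p - path_jump y s\<bar> < \<eta>"
    by (rule cadlag_on_increments_near[OF y, of s \<eta>]) (use s \<eta> in auto)
  have "t > 0" using s by simp
  have "(\<lambda>N. t / real N) \<longlonglongrightarrow> 0" by (rule lim_const_over_n)
  then have "\<forall>\<^sub>F N in sequentially. t / real N < d"
    using d(1) by (rule order_tendstoD(2))
  moreover have "\<forall>\<^sub>F N in sequentially. N \<ge> (1::nat)" by (rule eventually_ge_at_top)
  ultimately show ?thesis
  proof eventually_elim
    case (elim N)
    then have N: "real N > 0" by simp
    \<comment> \<open>the cell \<open>(t * i / N, t * (i + 1) / N]\<close> that contains \<open>s\<close>\<close>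
    define i where "i = nat (\<lceil>s * real N / t\<rceil> - 1)"
    have c1: "1 \<le> \<lceil>s * real N / t\<rceil>" using s N \<open>t > 0\<close> by (simp add: one_le_ceiling)
    have "s * real N / t \<le> real N" using s N \<open>t > 0\<close> by (simp add: field_simps)
    then have "\<lceil>s * real N / t\<rceil> \<le> int N" by (simp add: ceiling_le_iff)
    with c1 have "i < N" unfolding i_def by linarith
    have ri: "real i = real_of_int \<lceil>s * real N / t\<rceil> - 1" using c1 unfolding i_def by simp
    have "real i < s * real N / t" "s * real N / t \<le> real i + 1"
      unfolding ri by linarith+
    then have iv: "t * real i / real N < s" "s \<le> t * real (Suc i) / real N"
      using N \<open>t > 0\<close> by (simp_all add: field_simps)
    have gap: "t * real (Suc i) / real N = t * real i / real N + t / real N"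
      by (simp add: add_divide_distrib ring_distribs)
    have "real (Suc i) \<le> real N" using \<open>i < N\<close> by simp
    then have "t * real (Suc i) \<le> t * real N" using \<open>t > 0\<close> by (intro mult_left_mono) auto
    then have le: "t * real (Suc i) / real N \<le> t"
      using N by (simp add: pos_divide_le_eq)
    let ?\<Delta> = "\<lambda>i. y (t * real (Suc i) / real N) - y (t * real i / real N)"
    have tN: "t / real N < d" "0 < t / real N" using elim N \<open>t > 0\<close> by auto
    have "0 \<le> t * real i / real N" using N \<open>t > 0\<close> by simp
    then have "\<bar>?\<Delta> i - path_jump y s\<bar> < \<eta>"
      using iv gap le tN by (intro d(2)) (auto simp del: of_nat_Suc)
    then have "\<bar>path_jump y s\<bar> - \<eta> \<le> sqrt ((?\<Delta> i)\<^sup>2)" by simp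
    also have "\<dots> \<le> sqrt (\<Sum>i<N. (?\<Delta> i)\<^sup>2)"
      using \<open>i < N\<close> by (intro real_sqrt_le_mono member_le_sum) auto
    finally show ?case .
  qed
qed

text \<open>
  The intersection of all late events is as small as any one of them, hence null. This takes the place
  of an almost surely convergent subsequence of a sequence that converges in probability.
\<close>

lemma (in prob_space) AE_frequently_notin:
  assumes B: "\<And>N::nat. B N \<in> sets M" and small: "\<And>\<eta>. \<eta> > 0 \<Longrightarrow> \<exists>\<^sub>F N in sequentially. measure M (B N) < \<eta>"
  shows "AE \<omega> in M. \<exists>\<^sub>F N in sequentially. \<omega> \<notin> B N"
proof -
  define I where "I m = (\<Inter>N\<in>{m..}. B N)" for m
  have I_sets: "I m \<in> sets M" for m unfolding I_def using B by (intro sets.countable_INT') auto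
  have "I m \<in> null_sets M" for m
  proof -
    have "measure M (I m) \<le> 0"
    proof (rule field_le_epsilon)
      fix e :: real assume "e > 0"
      have "\<exists>\<^sub>F N in sequentially. measure M (B N) < e \<and> N \<ge> m"
        using small[OF \<open>e > 0\<close>] eventually_ge_at_top by (rule frequently_rev_mp[OF _ eventually_mono]) auto
      then obtain N where N: "measure M (B N) < e" "N \<ge> m" by (auto dest: frequently_ex)
      have "measure M (I m) \<le> measure M (B N)"
        using N B by (intro finite_measure_mono) (auto simp: I_def)
      with N show "measure M (I m) \<le> 0 + e" by simp
    qed
    then have "measure M (I m) = 0" by (simp add: measure_le_0_iff)
    then show ?thesis using I_sets by (simp add: null_sets_def emeasure_eq_measure)
  qed
  then have "AE \<omega> in M. \<omega> \<notin> I m" for m by (rule AE_not_in)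
  then have "AE \<omega> in M. \<forall>m. \<omega> \<notin> I m" by (simp add: AE_all_countable)
  then show ?thesis
    by eventually_elim (auto simp: I_def frequently_sequentially)
qed

text \<open>
  Almost surely the sums of squared increments come arbitrarily close to \<open>Q t\<close> infinitely often, and
  each of these sums for a fine partition nearly dominates any given squared jump. The exceptional
  null set comes from the sums alone, hence it is the same for all jump times \<open>s\<close>.
\<close>

lemma (in prob_space) AE_jump_squared_le_quadratic_variation:
  assumes qv: "has_quadratic_variation M t Y Q" and "t > 0"
    and meas: "\<And>s. s \<in> {0..t} \<Longrightarrow> Y s \<in> borel_measurable M"
    and cadlag: "\<And>\<omega>. \<omega> \<in> space M \<Longrightarrow> cadlag_on t (\<lambda>s. Y s \<omega>)"
  shows "AE \<omega> in M. \<forall>s\<in>{0<..t}. (jump Y s \<omega>)\<^sup>2 \<le> Q t \<omega>"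
proof -
  define p where "p N i = t * real i / real N" for N i :: nat
  define S where "S N \<omega> = (\<Sum>i<N. (Y (p N (Suc i)) \<omega> - Y (p N i) \<omega>)\<^sup>2)" for N \<omega>
  have p_in: "p N i \<in> {0..t}" if "i \<le> N" for N i
    using that \<open>t > 0\<close> by (cases "N = 0") (auto simp: p_def field_simps)
  have [measurable]: "S N \<in> borel_measurable M" for N
    unfolding S_def using p_in
    by (intro borel_measurable_sum borel_measurable_power borel_measurable_diff meas) auto
  have [measurable]: "Q t \<in> borel_measurable M"
    using qv \<open>t > 0\<close> by (auto simp: has_quadratic_variation_def)
  have part: "is_partition t N (p N)" if "N \<ge> 1" for N
    using that \<open>t > 0\<close> by (auto simp: is_partition_def p_def divide_strict_right_mono)
  define B where "B \<epsilon> N = {\<omega> \<in> space M. \<bar>S N \<omega> - Q t \<omega>\<bar> > \<epsilon>}" for \<epsilon> N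
  have B_sets: "B \<epsilon> N \<in> sets M" for \<epsilon> N unfolding B_def by measurable
  have "AE \<omega> in M. \<exists>\<^sub>F N in sequentially. \<omega> \<notin> B \<epsilon> N" if "\<epsilon> > 0" for \<epsilon>
  proof (rule AE_frequently_notin[OF B_sets])
    fix \<eta> :: real assume "\<eta> > 0"
    then obtain d where d: "d > 0" and
      dB: "\<And>N p. is_partition t N p \<and> (\<forall>i<N. p (Suc i) - p i < d) \<Longrightarrow>
         measure M {\<omega> \<in> space M. \<bar>(\<Sum>i<N. (Y (p (Suc i)) \<omega> - Y (p i) \<omega>)\<^sup>2) - Q t \<omega>\<bar> > \<epsilon>} < \<eta>"
      using bspec[OF qv[unfolded has_quadratic_variation_def], of t] \<open>t > 0\<close> \<open>\<epsilon> > 0\<close>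
      by (simp, blast)
    have "(\<lambda>N. t / real N) \<longlonglongrightarrow> 0" by (rule lim_const_over_n)
    then have "\<forall>\<^sub>F N in sequentially. t / real N < d"
      using d(1) by (rule order_tendstoD(2))
    moreover have "\<forall>\<^sub>F N in sequentially. N \<ge> (1::nat)" by (rule eventually_ge_at_top)
    ultimately have "\<forall>\<^sub>F N in sequentially. measure M (B \<epsilon> N) < \<eta>"
    proof eventually_elim
      case (elim N)
      have "p N (Suc i) - p N i = t / real N" for i
        by (simp add: p_def diff_divide_distrib[symmetric] ring_distribs)
      then show ?case
        unfolding B_def S_def using part[of N] elim by (intro dB) auto
    qed
    then show "\<exists>\<^sub>F N in sequentially. measure M (B \<epsilon> N) < \<eta>"
      by (rule eventually_frequently[rotated]) simp
  qed
  then have "AE \<omega> in M. \<exists>\<^sub>F N in sequentially. \<omega> \<notin> B (1 / real (Suc j)) N" for j by simp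
  then have "AE \<omega> in M. \<forall>j. \<exists>\<^sub>F N in sequentially. \<omega> \<notin> B (1 / real (Suc j)) N"
    by (simp add: AE_all_countable)
  then show ?thesis
  proof (rule AE_mp, intro AE_I2 impI ballI)
    fix \<omega> s assume \<omega>: "\<omega> \<in> space M" and fr: "\<forall>j. \<exists>\<^sub>F N in sequentially. \<omega> \<notin> B (1 / real (Suc j)) N"
      and s: "s \<in> {0<..t}"
    have *: "\<bar>jump Y s \<omega>\<bar> - \<eta> \<le> sqrt (Q t \<omega> + 1 / real (Suc j)) \<and> 0 \<le> Q t \<omega> + 1 / real (Suc j)"
      if "\<eta> > 0" for \<eta> j
    proof -
      have "\<forall>\<^sub>F N in sequentially. \<bar>path_jump (\<lambda>s. Y s \<omega>) s\<bar> - \<eta> \<le> sqrt (S N \<omega>)"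
        unfolding S_def p_def
        by (rule jump_le_sqrt_sum_squared_increments[OF cadlag[OF \<omega>]]) (use s that in auto)
      then have "\<exists>\<^sub>F N in sequentially. \<omega> \<notin> B (1 / real (Suc j)) N
          \<and> \<bar>path_jump (\<lambda>s. Y s \<omega>) s\<bar> - \<eta> \<le> sqrt (S N \<omega>)"
        using fr by (auto intro: frequently_rev_mp elim: eventually_mono)
      then obtain N where N: "\<omega> \<notin> B (1 / real (Suc j)) N"
          "\<bar>path_jump (\<lambda>s. Y s \<omega>) s\<bar> - \<eta> \<le> sqrt (S N \<omega>)"
        by (auto dest: frequently_ex)
      have le: "S N \<omega> \<le> Q t \<omega> + 1 / real (Suc j)" using N(1) \<omega> unfolding B_def by auto
      moreover have "0 \<le> S N \<omega>" unfolding S_def by (intro sum_nonneg) auto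
      moreover have "sqrt (S N \<omega>) \<le> sqrt (Q t \<omega> + 1 / real (Suc j))"
        using le by (rule real_sqrt_le_mono)
      ultimately show ?thesis
        using N(2) unfolding jump_eq_path_jump by linarith
    qed
    have bound: "(jump Y s \<omega>)\<^sup>2 \<le> Q t \<omega> + 1 / real (Suc j)" for j
    proof -
      have "\<bar>jump Y s \<omega>\<bar> \<le> sqrt (Q t \<omega> + 1 / real (Suc j))"
        by (rule field_le_epsilon) (use * in \<open>simp add: algebra_simps\<close>)
      then have "\<bar>jump Y s \<omega>\<bar>\<^sup>2 \<le> (sqrt (Q t \<omega> + 1 / real (Suc j)))\<^sup>2"
        by (rule power_mono) simp
      then show ?thesis using *[of 1 j] by simp
    qed
    have "(\<lambda>j. Q t \<omega> + 1 / real (Suc j)) \<longlonglongrightarrow> Q t \<omega> + 0"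
      using LIMSEQ_inverse_real_of_nat by (intro tendsto_intros) (simp add: divide_inverse)
    then have "(\<lambda>j. Q t \<omega> + 1 / real (Suc j)) \<longlonglongrightarrow> Q t \<omega>" by simp
    then show "(jump Y s \<omega>)\<^sup>2 \<le> Q t \<omega>"
      by (rule tendsto_lowerbound) (use bound in auto)
  qed
qed

section \<open>Hitting times of increasing adapted events\<close>

text \<open>If none of the events occurs, this is the infimum of the empty set, which is \<open>\<infinity>\<close>.\<close>

definition hitting_time :: "real \<Rightarrow> (real \<Rightarrow> 'a set) \<Rightarrow> 'a \<Rightarrow> ennreal" where
  "hitting_time t C \<omega> = Inf (ennreal ` {u \<in> {0..t}. \<omega> \<in> C u})"

lemma notin_before_hitting_time:
  assumes "u \<in> {0..t}" "ennreal u < hitting_time t C \<omega>"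
  shows "\<omega> \<notin> C u"
proof
  assume "\<omega> \<in> C u"
  then have "hitting_time t C \<omega> \<le> ennreal u"
    unfolding hitting_time_def using assms(1) by (intro Inf_lower) auto
  with assms(2) show False by simp
qed

lemma in_if_hitting_time_le:
  assumes mono: "\<And>u v. 0 \<le> u \<Longrightarrow> u \<le> v \<Longrightarrow> v \<le> t \<Longrightarrow> C u \<subseteq> C v"
    and "hitting_time t C \<omega> \<le> ennreal t"
  shows "\<omega> \<in> C t"
proof -
  have "{u \<in> {0..t}. \<omega> \<in> C u} \<noteq> {}"
  proof
    assume "{u \<in> {0..t}. \<omega> \<in> C u} = {}"
    then have "hitting_time t C \<omega> = \<top>" unfolding hitting_time_def by simp
    with assms(2) show False by (simp add: top_unique)
  qed
  then show ?thesis using mono[of _ t] by auto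
qed

context usual_filtered_prob_space
begin

lemma sets_F_subset: "sets (F u) \<subseteq> sets M"
  using subalgebra_F by (auto simp: subalgebra_def)

lemma borel_measurable_F_mono:
  assumes "f \<in> borel_measurable (F u)" "u \<le> v"
  shows "f \<in> borel_measurable (F v)"
  using assms sets_F_mono[OF \<open>u \<le> v\<close>] by (auto simp: measurable_def space_F)

lemma borel_measurable_F_imp_M:
  assumes "f \<in> borel_measurable (F u)"
  shows "f \<in> borel_measurable M"
  using measurable_from_subalg[OF subalgebra_F assms] .

text \<open>
  By right-continuity of the filtration it suffices that \<open>{T < v} \<in> F v\<close> for all \<open>v\<close>. Monotonicity of
  the events makes \<open>{T < v}\<close> a union over rational times, to which \<open>t\<close> is added because the events stop
  there.
\<close>

lemma stopping_time_hitting_time: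
  assumes "t > 0" and C: "\<And>u. 0 \<le> u \<Longrightarrow> u \<le> t \<Longrightarrow> C u \<in> sets (F (ennreal u))"
    and mono: "\<And>u v. 0 \<le> u \<Longrightarrow> u \<le> v \<Longrightarrow> v \<le> t \<Longrightarrow> C u \<subseteq> C v"
  shows "stopping_time F (hitting_time t C)"
proof -
  let ?T = "hitting_time t C"
  have less: "{\<omega> \<in> space M. ?T \<omega> < ennreal v} \<in> sets (F (ennreal v))" for v
  proof -
    let ?D = "{u \<in> insert t (\<rat> \<inter> {0..t}). ennreal u < ennreal v}"
    have "{\<omega> \<in> space M. ?T \<omega> < ennreal v} = (\<Union>u\<in>?D. C u)"
    proof (intro equalityI subsetI)
      fix \<omega> assume "\<omega> \<in> {\<omega> \<in> space M. ?T \<omega> < ennreal v}"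
      then obtain u where u: "0 \<le> u" "u \<le> t" "\<omega> \<in> C u" "ennreal u < ennreal v"
        by (auto simp: hitting_time_def Inf_less_iff)
      have uv: "u < v" using u by (simp add: ennreal_less_iff)
      show "\<omega> \<in> (\<Union>u\<in>?D. C u)"
      proof (cases "t < v")
        case True
        then show ?thesis
          using u mono[of u t] \<open>t > 0\<close> by (intro UN_I[of t]) (auto simp: ennreal_less_iff)
      next
        case False
        obtain w where w: "w \<in> \<rat>" "u < w" "w < v" using Rats_dense_in_real[OF uv] by blast
        then show ?thesis
          using u mono[of u w] False by (intro UN_I[of w]) (auto simp: ennreal_less_iff)
      qed
    next
      fix \<omega> assume "\<omega> \<in> (\<Union>u\<in>?D. C u)"
      then obtain u where "u \<in> ?D" "\<omega> \<in> C u" by blast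
      with \<open>t > 0\<close> have u: "u \<in> {0..t}" "\<omega> \<in> C u" "ennreal u < ennreal v" by auto
      then have "\<omega> \<in> space M" using C[of u] sets.sets_into_space[of "C u" "F u"] by (auto simp: space_F)
      with u show "\<omega> \<in> {\<omega> \<in> space M. ?T \<omega> < ennreal v}"
        by (auto simp: hitting_time_def Inf_less_iff)
    qed
    moreover have "countable ?D" by (rule countable_Collect) (auto intro: countable_rat)
    moreover have "C u \<in> sets (F (ennreal v))" if "u \<in> ?D" for u
    proof -
      from that \<open>t > 0\<close> have "0 \<le> u" "u \<le> t" "ennreal u \<le> ennreal v" by (auto intro: less_imp_le)
      then show ?thesis using C sets_F_mono by blast
    qed
    ultimately show ?thesis by (auto intro: sets.countable_UN')
  qed
  show ?thesis
  proof (rule stopping_timeI)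
    fix v :: ennreal
    show "Measurable.pred (F v) (\<lambda>\<omega>. ?T \<omega> \<le> v)"
    proof (cases "v = \<infinity>")
      case True
      then show ?thesis by simp
    next
      case False
      then obtain a where a: "v = ennreal a" "a \<ge> 0" by (cases v) auto
      have "{\<omega> \<in> space M. ?T \<omega> \<le> v} \<in> sets (F w)" if w: "w \<in> {v<..<\<infinity>}" for w
      proof -
        obtain b where b: "w = ennreal b" "b > a"
          using w a by (cases w) (auto simp: ennreal_less_iff)
        let ?v = "\<lambda>n. a + (b - a) / real (Suc n)"
        have lim: "(\<lambda>n. ennreal (?v n)) \<longlonglongrightarrow> ennreal a"
        proof -
          have "(\<lambda>n. a + (b - a) * inverse (real (Suc n))) \<longlonglongrightarrow> a + (b - a) * 0"
            by (intro tendsto_intros LIMSEQ_inverse_real_of_nat)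
          then show ?thesis by (intro tendsto_ennrealI) (simp add: divide_inverse)
        qed
        have gt: "ennreal a < ennreal (?v n)" for n
          using a b by (intro ennreal_lessI) (auto intro!: add_nonneg_pos)
        have "{\<omega> \<in> space M. ?T \<omega> \<le> v} = (\<Inter>n. {\<omega> \<in> space M. ?T \<omega> < ennreal (?v n)})"
        proof (intro equalityI subsetI)
          fix \<omega> assume "\<omega> \<in> {\<omega> \<in> space M. ?T \<omega> \<le> v}"
          then show "\<omega> \<in> (\<Inter>n. {\<omega> \<in> space M. ?T \<omega> < ennreal (?v n)})"
            using gt a by (auto intro: le_less_trans)
        next
          fix \<omega> assume "\<omega> \<in> (\<Inter>n. {\<omega> \<in> space M. ?T \<omega> < ennreal (?v n)})"
          then have "\<omega> \<in> space M" "\<And>n. ?T \<omega> \<le> ennreal (?v n)" by (auto intro: less_imp_le)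
          then show "\<omega> \<in> {\<omega> \<in> space M. ?T \<omega> \<le> v}"
            using LIMSEQ_le_const[OF lim] a by auto
        qed
        moreover have "{\<omega> \<in> space M. ?T \<omega> < ennreal (?v n)} \<in> sets (F w)" for n
        proof -
          have "(b - a) / real (Suc n) \<le> (b - a) / 1" using b by (intro divide_left_mono) auto
          then have "ennreal (?v n) \<le> w" unfolding b by (intro ennreal_leI) simp
          then show ?thesis using less sets_F_mono by blast
        qed
        ultimately show ?thesis by (auto intro!: sets.countable_INT)
      qed
      then have "{\<omega> \<in> space M. ?T \<omega> \<le> v} \<in> sets (F v)"
        using right_continuous_F[of v] False by (auto simp: less_top)
      then show ?thesis by (simp add: pred_def space_F)
    qed
  qed
qed

lemma jump_in_closed_event:
  assumes Y: "adapted_cadlag M F t Y" and a: "0 \<le> a" "a \<le> u" "u \<le> t"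
    and K: "closed K" "0 \<notin> K"
  shows "{\<omega> \<in> space M. \<exists>s\<in>{a<..u}. jump Y s \<omega> \<in> K} \<in> sets (F (ennreal u))"
proof (cases "K = {} \<or> a = u")
  case True
  then have "{\<omega> \<in> space M. \<exists>s\<in>{a<..u}. jump Y s \<omega> \<in> K} = {}" by auto
  then show ?thesis by (metis sets.empty_sets)
next
  case False
  define D where "D = insert u (\<rat> \<inter> {a<..<u})"
  have D: "D \<subseteq> {a..u}" using a by (auto simp: D_def)
  have cD: "countable D" unfolding D_def by (auto intro: countable_rat)
  have eq: "{\<omega> \<in> space M. \<exists>s\<in>{a<..u}. jump Y s \<omega> \<in> K} =
    {\<omega> \<in> space (F (ennreal u)). \<forall>j. \<exists>p\<in>D. \<exists>q\<in>D. p < q \<and> q - p < 1 / real (Suc j) \<and>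
       infdist (Y q \<omega> - Y p \<omega>) K < 1 / real (Suc j)}"
    unfolding jump_eq_path_jump D_def space_F using Y False a K
    by (intro Collect_cong conj_cong refl path_jump_in_closed_iff[where t = t])
      (auto simp: adapted_cadlag_def)
  have Ym: "Y p \<in> borel_measurable (F (ennreal u))" if "p \<in> D" for p
  proof (rule borel_measurable_F_mono)
    have "p \<in> {0..t}" using that D a by auto
    then show "Y p \<in> borel_measurable (F (ennreal p))"
      using Y unfolding adapted_cadlag_def adapted_on_def by blast
    show "ennreal p \<le> ennreal u" using that D by (intro ennreal_leI) auto
  qed
  have inf: "(\<lambda>x. infdist x K) \<in> borel_measurable borel"
    by (intro borel_measurable_continuous_onI continuous_on_infdist continuous_on_id)
  have "Measurable.pred (F (ennreal u)) (\<lambda>\<omega>. \<forall>j. \<exists>p\<in>D. \<exists>q\<in>D. p < q \<and> q - p < 1 / real (Suc j) \<and>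
       infdist (Y q \<omega> - Y p \<omega>) K < 1 / real (Suc j))"
  proof (intro pred_intros_countable measurable_pred_countable cD)
    fix j p q assume [simp]: "p \<in> D" "q \<in> D"
    have "(\<lambda>\<omega>. infdist (Y q \<omega> - Y p \<omega>) K) \<in> borel_measurable (F (ennreal u))"
      by (rule measurable_compose[OF _ inf]) (intro borel_measurable_diff Ym; simp)
    then show "Measurable.pred (F (ennreal u)) (\<lambda>\<omega>. p < q \<and> q - p < 1 / real (Suc j) \<and>
       infdist (Y q \<omega> - Y p \<omega>) K < 1 / real (Suc j))" by measurable
  qed
  then show ?thesis unfolding eq pred_def .
qed

lemma number_of_large_jumps_event:
  assumes Y: "adapted_cadlag M F t Y" and "a > 0" and u: "0 \<le> u" "u \<le> t"
  shows "{\<omega> \<in> space M. j \<le> card {s \<in> {0<..u}. \<bar>jump Y s \<omega>\<bar> \<ge> a}} \<in> sets (F (ennreal u))"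
  using u
proof (induction j arbitrary: u)
  case 0
  then show ?case using sets.top[of "F (ennreal u)"] by (simp add: space_F)
next
  case (Suc j)
  have eq: "{\<omega> \<in> space M. Suc j \<le> card {s \<in> {0<..u}. \<bar>jump Y s \<omega>\<bar> \<ge> a}} =
    (\<Union>p\<in>\<rat> \<inter> {0..<u}. {\<omega> \<in> space M. j \<le> card {s \<in> {0<..p}. \<bar>jump Y s \<omega>\<bar> \<ge> a}} \<inter>
       {\<omega> \<in> space M. \<exists>s\<in>{p<..u}. jump Y s \<omega> \<in> {x. \<bar>x\<bar> \<ge> a}})" (is "?L = ?R")
  proof (rule set_eqI)
    fix \<omega>
    show "\<omega> \<in> ?L \<longleftrightarrow> \<omega> \<in> ?R"
    proof (cases "\<omega> \<in> space M")
      case True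
      then have "cadlag_on t (\<lambda>s. Y s \<omega>)" using Y by (auto simp: adapted_cadlag_def)
      then have "finite {s \<in> {0<..t}. \<bar>jump Y s \<omega>\<bar> \<ge> a}"
        unfolding jump_eq_path_jump using \<open>a > 0\<close> by (rule cadlag_on_finite_large_jumps)
      then have "finite {s \<in> {0<..u}. \<bar>jump Y s \<omega>\<bar> \<ge> a}"
        by (rule finite_subset[rotated]) (use Suc.prems in auto)
      from Suc_le_card_Ioc_iff[OF this, of j] True show ?thesis by auto
    qed auto
  qed
  have closed: "closed {x::real. \<bar>x\<bar> \<ge> a}" by (intro closed_Collect_le continuous_intros)
  show ?case
    unfolding eq
  proof (intro sets.countable_UN'' sets.Int)
    show "countable (\<rat> \<inter> {0..<u})" by (auto intro: countable_rat)
    fix p assume p: "p \<in> \<rat> \<inter> {0..<u}"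
    then have "ennreal p \<le> ennreal u" by (intro ennreal_leI) simp
    from sets_F_mono[OF this] show
      "{\<omega> \<in> space M. j \<le> card {s \<in> {0<..p}. \<bar>jump Y s \<omega>\<bar> \<ge> a}} \<in> sets (F (ennreal u))"
      using Suc.IH[of p] p Suc.prems by auto
    show "{\<omega> \<in> space M. \<exists>s\<in>{p<..u}. jump Y s \<omega> \<in> {x. \<bar>x\<bar> \<ge> a}} \<in> sets (F (ennreal u))"
      using p Suc.prems \<open>a > 0\<close> by (intro jump_in_closed_event[OF Y] closed) auto
  qed
qed

end

section \<open>Predictable sets and thin sets\<close>

context usual_filtered_prob_space
begin

lemma predictable_generators_subset:
  "{{0} \<times> A | A. A \<in> sets (F 0)} \<union>
   {{s<..u} \<times> A | s u A. 0 \<le> s \<and> s \<le> u \<and> A \<in> sets (F (ennreal s))} \<subseteq> Pow ({0..} \<times> space M)"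
  using sets.sets_into_space[of _ "F _"] by (fastforce simp: space_F)

lemma space_predictable_sigma: "space (predictable_sigma M F) = {0..} \<times> space M"
  unfolding predictable_sigma_def by (intro space_measure_of predictable_generators_subset)

lemma predictable_rectangle:
  assumes "0 \<le> s" "s \<le> u" "A \<in> sets (F (ennreal s))"
  shows "{s<..u} \<times> A \<in> sets (predictable_sigma M F)"
  unfolding predictable_sigma_def sets_measure_of[OF predictable_generators_subset]
  using assms by (intro sigma_sets.Basic) blast

lemma predictable_rectangle_zero:
  assumes "A \<in> sets (F 0)"
  shows "{0} \<times> A \<in> sets (predictable_sigma M F)"
  unfolding predictable_sigma_def sets_measure_of[OF predictable_generators_subset]
  using assms by (intro sigma_sets.Basic) blast

lemma space_M_in_sets_F: "space M \<in> sets (F u)"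
  using sets.top[of "F u"] by (simp add: space_F)

lemma Icc_times_space_predictable:
  assumes "0 \<le> t"
  shows "{0..t} \<times> space M \<in> sets (predictable_sigma M F)"
proof -
  have "{0..t} \<times> space M = {0} \<times> space M \<union> {0<..t} \<times> space M" using assms by auto
  also have "\<dots> \<in> sets (predictable_sigma M F)"
    using assms by (intro sets.Un predictable_rectangle predictable_rectangle_zero space_M_in_sets_F) auto
  finally show ?thesis .
qed

lemma sets_predictable_sigma_on_iff:
  assumes "0 \<le> t"
  shows "D \<in> sets (predictable_sigma_on M F t) \<longleftrightarrow>
    D \<subseteq> {0..t} \<times> space M \<and> D \<in> sets (predictable_sigma M F)"
proof -
  have "({0..t} \<times> space M) \<inter> space (predictable_sigma M F) = {0..t} \<times> space M"
    by (auto simp: space_predictable_sigma)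
  with Icc_times_space_predictable[OF assms] show ?thesis
    unfolding predictable_sigma_on_def by (subst sets_restrict_space_iff) auto
qed

lemma space_predictable_sigma_on: "space (predictable_sigma_on M F t) = {0..t} \<times> space M"
  unfolding predictable_sigma_on_def by (auto simp: space_restrict_space space_predictable_sigma)

text \<open>
  A stopping time only has to be known at the rational times \<open>q < s\<close> in order to decide whether
  \<open>T < s\<close>, which makes the stochastic interval up to and including \<open>T\<close> predictable.
\<close>

lemma predictable_stochastic_interval:
  assumes T: "stopping_time F T"
  shows "{(s, \<omega>). 0 \<le> s \<and> \<omega> \<in> space M \<and> ennreal s \<le> T \<omega>} \<in> sets (predictable_sigma M F)"
proof -
  let ?R = "\<lambda>q N. {q<..q + real N} \<times> {\<omega> \<in> space M. T \<omega> \<le> ennreal q}"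
  have "{(s, \<omega>). 0 \<le> s \<and> \<omega> \<in> space M \<and> ennreal s \<le> T \<omega>} =
    space (predictable_sigma M F) - (\<Union>q\<in>\<rat> \<inter> {0..}. \<Union>N. ?R q N)"
  proof (intro equalityI subsetI)
    fix z assume "z \<in> {(s, \<omega>). 0 \<le> s \<and> \<omega> \<in> space M \<and> ennreal s \<le> T \<omega>}"
    then show "z \<in> space (predictable_sigma M F) - (\<Union>q\<in>\<rat> \<inter> {0..}. \<Union>N. ?R q N)"
      by (auto simp: space_predictable_sigma dest: order_trans)
  next
    fix z assume z: "z \<in> space (predictable_sigma M F) - (\<Union>q\<in>\<rat> \<inter> {0..}. \<Union>N. ?R q N)"
    then obtain s \<omega> where s: "z = (s, \<omega>)" "0 \<le> s" "\<omega> \<in> space M" by (auto simp: space_predictable_sigma)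
    have "ennreal s \<le> T \<omega>"
    proof (rule ccontr)
      assume "\<not> ennreal s \<le> T \<omega>"
      then have lt: "T \<omega> < ennreal s" by simp
      then obtain a where a: "T \<omega> = ennreal a" "0 \<le> a" by (cases "T \<omega>") auto
      then have "a < s" using lt by (simp add: ennreal_less_iff)
      then obtain q where q: "q \<in> \<rat>" "a < q" "q < s" using Rats_dense_in_real by blast
      obtain N :: nat where "s - q \<le> real N" using real_arch_simple by blast
      then have "(s, \<omega>) \<in> ?R q N" using q s a by (auto intro: ennreal_leI)
      moreover have "q \<in> \<rat> \<inter> {0..}" using q a by auto
      ultimately show False using z s by blast
    qed
    with s show "z \<in> {(s, \<omega>). 0 \<le> s \<and> \<omega> \<in> space M \<and> ennreal s \<le> T \<omega>}" by simp
  qed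
  moreover have "countable (\<rat> \<inter> {0::real..})" by (auto intro: countable_rat)
  moreover have "?R q N \<in> sets (predictable_sigma M F)" if "q \<in> \<rat> \<inter> {0..}" for q N
    using that stopping_timeD[OF T, of "ennreal q"]
    by (intro predictable_rectangle) (auto simp: pred_def space_F)
  ultimately show ?thesis by (auto intro!: sets.Diff sets.countable_UN'')
qed

lemma stopping_time_graph_predictable:
  assumes T: "predictable_stopping_time M F T"
  shows "stopping_time_graph M T \<in> sets (predictable_sigma M F)"
proof -
  have "stopping_time_graph M T = {(s, \<omega>). 0 \<le> s \<and> \<omega> \<in> space M \<and> ennreal s \<le> T \<omega>}
     - {(s, \<omega>). 0 \<le> s \<and> \<omega> \<in> space M \<and> ennreal s < T \<omega>}"
    by (auto simp: stopping_time_graph_def)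
  then show ?thesis
    using T predictable_stochastic_interval by (auto simp: predictable_stopping_time_def)
qed

lemma thin_predictable:
  assumes "thin_exhausted_by_predictable M F D"
  shows "D \<in> sets (predictable_sigma M F)"
  using assms stopping_time_graph_predictable unfolding thin_exhausted_by_predictable_def by auto

lemma thin_countable_sections:
  assumes "thin_exhausted_by_predictable M F D"
  shows "countable {u. (u, \<omega>) \<in> D}"
proof -
  obtain T where D: "D = (\<Union>m::nat. stopping_time_graph M (T m))"
    using assms unfolding thin_exhausted_by_predictable_def by auto
  have "{u. (u, \<omega>) \<in> D} \<subseteq> range (\<lambda>m. enn2real (T m \<omega>))"
  proof
    fix u assume "u \<in> {u. (u, \<omega>) \<in> D}"
    then obtain m where "T m \<omega> = ennreal u" "0 \<le> u" by (auto simp: D stopping_time_graph_def)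
    then have "u = enn2real (T m \<omega>)" by simp
    then show "u \<in> range (\<lambda>m. enn2real (T m \<omega>))" by blast
  qed
  then show ?thesis by (rule countable_subset) simp
qed

lemma atom_set_predictable:
  assumes "jump_compensator M F t X \<nu>" "0 \<le> t"
  shows "atom_set M t \<nu> \<in> sets (predictable_sigma_on M F t)"
proof -
  have "atom_set M t \<nu> \<in> sets (predictable_sigma M F)"
    using assms(1) unfolding jump_compensator_def by (intro thin_predictable) (elim conjE)
  moreover have "atom_set M t \<nu> \<subseteq> {0..t} \<times> space M" by (auto simp: atom_set_def)
  ultimately show ?thesis using sets_predictable_sigma_on_iff[OF assms(2)] by blast
qed

text \<open>
  Composition with this map evaluates predictable processes at the random time \<open>\<tau>\<close>. A constant \<open>\<tau>\<close>
  gives the measurability of a predictable process at a fixed time.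
\<close>

lemma measurable_graph_predictable:
  assumes \<tau>: "\<tau> \<in> borel_measurable M" "\<And>\<omega>. \<omega> \<in> space M \<Longrightarrow> \<tau> \<omega> \<in> {0..t}"
  shows "(\<lambda>\<omega>. (\<tau> \<omega>, \<omega>)) \<in> M \<rightarrow>\<^sub>M predictable_sigma_on M F t"
  unfolding predictable_sigma_on_def
proof (rule measurable_restrict_space2)
  show "(\<lambda>\<omega>. (\<tau> \<omega>, \<omega>)) \<in> space M \<rightarrow> {0..t} \<times> space M" using \<tau>(2) by auto
  show "(\<lambda>\<omega>. (\<tau> \<omega>, \<omega>)) \<in> M \<rightarrow>\<^sub>M predictable_sigma M F"
    unfolding predictable_sigma_def
  proof (rule measurable_measure_of[OF predictable_generators_subset])
    show "(\<lambda>\<omega>. (\<tau> \<omega>, \<omega>)) \<in> space M \<rightarrow> {0..} \<times> space M" using \<tau>(2) by auto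
    fix Z assume "Z \<in> {{0} \<times> A | A. A \<in> sets (F 0)} \<union>
      {{s<..u} \<times> A | s u A. 0 \<le> s \<and> s \<le> u \<and> A \<in> sets (F (ennreal s))}"
    then consider A where "Z = {0} \<times> A" "A \<in> sets (F 0)"
      | s u A where "Z = {s<..u} \<times> A" "A \<in> sets (F (ennreal s))" by blast
    then obtain I A where Z: "Z = I \<times> A" "I \<in> sets borel" "A \<in> sets M"
    proof cases
      case (1 A)
      then show ?thesis using sets_F_subset by (intro that[of "{0}" A]) auto
    next
      case (2 s u A)
      then show ?thesis using sets_F_subset by (intro that[of "{s<..u}" A]) auto
    qed
    have "(\<lambda>\<omega>. (\<tau> \<omega>, \<omega>)) -` Z \<inter> space M = (\<tau> -` I \<inter> space M) \<inter> A"
      using Z sets.sets_into_space[OF Z(3)] by auto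
    also have "\<dots> \<in> sets M" using Z measurable_sets[OF \<tau>(1)] by auto
    finally show "(\<lambda>\<omega>. (\<tau> \<omega>, \<omega>)) -` Z \<inter> space M \<in> sets M" .
  qed
qed

section \<open>Compensator identity on thin predictable sets\<close>

lemma borel_times_in_jump_space:
  assumes "countable E" "E \<subseteq> {0..t}" "B \<in> sets (borel :: real measure)"
  shows "E \<times> B \<in> sets (jump_space t)"
proof -
  have "E \<in> sets borel" using assms(1) by (rule sets.countable[rotated]) auto
  then have "E \<times> B \<in> sets (borel :: (real \<times> real) measure)"
    unfolding borel_prod[symmetric] using assms by (intro pair_measureI) auto
  moreover have "{0..t} \<times> UNIV \<in> sets (borel :: (real \<times> real) measure)"
    by (intro borel_closed closed_Times closed_real_atLeastAtMost closed_UNIV)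
  ultimately show ?thesis
    unfolding jump_space_def using assms by (subst sets_restrict_space_iff) auto
qed

text \<open>
  Over a predictable set with countable sections the compensator only sees its atoms, and the
  integral against it becomes a sum. The next lemmas turn both sides of the defining equation of the
  compensator into sums over \<open>[0,t]\<close>.
\<close>

lemma nn_integral_countable_times:
  assumes N: "sets N = sets (jump_space t)" and E: "countable E" "E \<subseteq> {0..t}" and B: "B \<in> sets borel"
  shows "(\<integral>\<^sup>+ (u, x). indicator E u * indicator B x \<partial>N) =
    (\<integral>\<^sup>+ u. indicator E u * emeasure N ({u} \<times> B) \<partial>count_space {0..t})"
proof -
  have EB: "E' \<times> B \<in> sets N" if "E' \<subseteq> E" for E'
    unfolding N using E B countable_subset[OF that E(1)] that by (intro borel_times_in_jump_space) auto
  have "(\<integral>\<^sup>+ (u, x). indicator E u * indicator B x \<partial>N) = (\<integral>\<^sup>+ z. indicator (E \<times> B) z \<partial>N)"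
    by (intro nn_integral_cong) (auto simp: indicator_def split: prod.splits)
  also have "\<dots> = emeasure N (E \<times> B)" using EB by simp
  also have "E \<times> B = (\<Union>u\<in>E. {u} \<times> B)" by auto
  also have "emeasure N \<dots> = (\<integral>\<^sup>+ u. emeasure N ({u} \<times> B) \<partial>count_space E)"
    using E EB by (intro emeasure_UN_countable) (auto simp: disjoint_family_on_def)
  also have "\<dots> = (\<integral>\<^sup>+ u. emeasure N ({u} \<times> B) * indicator E u \<partial>count_space UNIV)"
    by (rule nn_integral_count_space_indicator) simp
  also have "\<dots> = (\<integral>\<^sup>+ u. indicator E u * emeasure N ({u} \<times> B) \<partial>count_space {0..t})"
    using E by (subst mult.commute) (intro nn_integral_count_space_eq, auto simp: indicator_def)
  finally show ?thesis .
qed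

lemma nn_integral_jump_measure:
  assumes E: "countable E" "E \<subseteq> {0..t}" and B: "B \<in> sets borel" "0 \<notin> B"
  shows "(\<integral>\<^sup>+ (u, x). indicator E u * indicator B x \<partial>jump_measure t X \<omega>) =
    (\<integral>\<^sup>+ u. indicator E u * indicator B (jump X u \<omega>) \<partial>count_space {0..t})"
proof -
  let ?J = "{u \<in> {0..t}. jump X u \<omega> \<noteq> 0}"
  have "(\<lambda>(u, x). indicator E u * indicator B x :: ennreal) = indicator (E \<times> B)"
    by (auto simp: indicator_def fun_eq_iff)
  then have meas: "(\<lambda>(u, x). indicator E u * indicator B x :: ennreal) \<in> borel_measurable (jump_space t)"
    using borel_times_in_jump_space[OF E B(1)] by simp
  have "(\<lambda>u. (u, jump X u \<omega>)) \<in> count_space ?J \<rightarrow>\<^sub>M jump_space t"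
    by (auto simp: jump_space_def space_restrict_space)
  then have "(\<integral>\<^sup>+ (u, x). indicator E u * indicator B x \<partial>jump_measure t X \<omega>) =
    (\<integral>\<^sup>+ u. indicator E u * indicator B (jump X u \<omega>) \<partial>count_space ?J)"
    unfolding jump_measure_def by (subst nn_integral_distr) (use meas in \<open>simp_all\<close>)
  also have "\<dots> = (\<integral>\<^sup>+ u. indicator E u * indicator B (jump X u \<omega>) \<partial>count_space {0..t})"
    using B by (intro nn_integral_count_space_eq) auto
  finally show ?thesis .
qed

lemma simple_integrand_measurable:
  assumes D: "D \<in> sets (predictable_sigma_on M F t)" and B: "B \<in> sets borel"
  shows "(\<lambda>(z, x). indicator D z * indicator B x :: ennreal) \<in>
    borel_measurable (predictable_sigma_on M F t \<Otimes>\<^sub>M (borel :: real measure))"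
proof -
  have "(\<lambda>(z, x). indicator D z * indicator B x :: ennreal) = indicator (D \<times> B)"
    by (rule ext) (simp add: indicator_times split_beta)
  moreover have "D \<times> B \<in> sets (predictable_sigma_on M F t \<Otimes>\<^sub>M (borel :: real measure))"
    using D B by (rule pair_measureI)
  ultimately show ?thesis by simp
qed

lemma section_subset:
  assumes "D \<in> sets (predictable_sigma_on M F t)"
  shows "{u. (u, \<omega>) \<in> D} \<subseteq> {0..t}"
  using sets.sets_into_space[OF assms] by (auto simp: space_predictable_sigma_on)

context
  fixes t X \<nu>
  assumes t: "0 \<le> t" and comp: "predictable_compensator M F t (jump_measure t X) \<nu>"
begin

lemma sets_compensator: "\<omega> \<in> space M \<Longrightarrow> sets (\<nu> \<omega>) = sets (jump_space t)"
  using comp unfolding predictable_compensator_def by (elim conjE) (rule bspec)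

lemma compensatorD:
  assumes "W \<in> borel_measurable (predictable_sigma_on M F t \<Otimes>\<^sub>M borel)"
  shows "(\<lambda>(s, \<omega>). \<integral>\<^sup>+ (u, x). W ((u, \<omega>), x) * indicator {0..s} u \<partial>\<nu> \<omega>)
      \<in> borel_measurable (predictable_sigma_on M F t)"
    and "(\<integral>\<^sup>+ \<omega>. (\<integral>\<^sup>+ (u, x). W ((u, \<omega>), x) \<partial>\<nu> \<omega>) \<partial>M) =
      (\<integral>\<^sup>+ \<omega>. (\<integral>\<^sup>+ (u, x). W ((u, \<omega>), x) \<partial>jump_measure t X \<omega>) \<partial>M)"
proof -
  note D = comp[unfolded predictable_compensator_def, THEN conjunct2, THEN spec[of _ W], THEN mp, OF assms]
  from D show "(\<lambda>(s, \<omega>). \<integral>\<^sup>+ (u, x). W ((u, \<omega>), x) * indicator {0..s} u \<partial>\<nu> \<omega>)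
      \<in> borel_measurable (predictable_sigma_on M F t)" by (rule conjunct1)
  from D show "(\<integral>\<^sup>+ \<omega>. (\<integral>\<^sup>+ (u, x). W ((u, \<omega>), x) \<partial>\<nu> \<omega>) \<partial>M) =
      (\<integral>\<^sup>+ \<omega>. (\<integral>\<^sup>+ (u, x). W ((u, \<omega>), x) \<partial>jump_measure t X \<omega>) \<partial>M)" by (rule conjunct2)
qed

lemma compensator_integral_predictable:
  assumes D: "D \<in> sets (predictable_sigma_on M F t)" and B: "B \<in> sets borel"
  shows "(\<lambda>(s, \<omega>). \<integral>\<^sup>+ (u, x). indicator D (u, \<omega>) * indicator B x * indicator {0..s} u \<partial>\<nu> \<omega>)
    \<in> borel_measurable (predictable_sigma_on M F t)"
  using compensatorD(1)[OF simple_integrand_measurable[OF D B]] by (simp only: prod.case)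

lemma compensator_identity:
  assumes D: "D \<in> sets (predictable_sigma_on M F t)" "\<And>\<omega>. \<omega> \<in> space M \<Longrightarrow> countable {u. (u, \<omega>) \<in> D}"
    and B: "B \<in> sets borel" "0 \<notin> B"
  shows "(\<integral>\<^sup>+ \<omega>. (\<integral>\<^sup>+ u. indicator D (u, \<omega>) * emeasure (\<nu> \<omega>) ({u} \<times> B) \<partial>count_space {0..t}) \<partial>M) =
    (\<integral>\<^sup>+ \<omega>. (\<integral>\<^sup>+ u. indicator D (u, \<omega>) * indicator B (jump X u \<omega>) \<partial>count_space {0..t}) \<partial>M)"
proof -
  let ?E = "\<lambda>\<omega>. {u. (u, \<omega>) \<in> D}"
  have ind: "indicator D (u, \<omega>) = (indicator (?E \<omega>) u :: ennreal)" for u \<omega>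
    by (simp add: indicator_def)
  have "(\<integral>\<^sup>+ \<omega>. (\<integral>\<^sup>+ (u, x). indicator D (u, \<omega>) * indicator B x \<partial>\<nu> \<omega>) \<partial>M) =
    (\<integral>\<^sup>+ \<omega>. (\<integral>\<^sup>+ (u, x). indicator D (u, \<omega>) * indicator B x \<partial>jump_measure t X \<omega>) \<partial>M)"
    using compensatorD(2)[OF simple_integrand_measurable[OF D(1) B(1)]] by (simp only: prod.case)
  moreover have "(\<integral>\<^sup>+ (u, x). indicator D (u, \<omega>) * indicator B x \<partial>\<nu> \<omega>) =
      (\<integral>\<^sup>+ u. indicator D (u, \<omega>) * emeasure (\<nu> \<omega>) ({u} \<times> B) \<partial>count_space {0..t})" if "\<omega> \<in> space M" for \<omega>
    unfolding ind using that D B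
    by (intro nn_integral_countable_times sets_compensator section_subset) auto
  moreover have "(\<integral>\<^sup>+ (u, x). indicator D (u, \<omega>) * indicator B x \<partial>jump_measure t X \<omega>) =
      (\<integral>\<^sup>+ u. indicator D (u, \<omega>) * indicator B (jump X u \<omega>) \<partial>count_space {0..t})" if "\<omega> \<in> space M" for \<omega>
    unfolding ind using that D B by (intro nn_integral_jump_measure section_subset) auto
  ultimately show ?thesis
    using nn_integral_cong[of M
        "\<lambda>\<omega>. \<integral>\<^sup>+ (u, x). indicator D (u, \<omega>) * indicator B x \<partial>\<nu> \<omega>"
        "\<lambda>\<omega>. \<integral>\<^sup>+ u. indicator D (u, \<omega>) * emeasure (\<nu> \<omega>) ({u} \<times> B) \<partial>count_space {0..t}"]
      nn_integral_cong[of M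
        "\<lambda>\<omega>. \<integral>\<^sup>+ (u, x). indicator D (u, \<omega>) * indicator B x \<partial>jump_measure t X \<omega>"
        "\<lambda>\<omega>. \<integral>\<^sup>+ u. indicator D (u, \<omega>) * indicator B (jump X u \<omega>) \<partial>count_space {0..t}"]
    by argo
qed

lemma compensator_sum_measurable:
  assumes D: "D \<in> sets (predictable_sigma_on M F t)" "\<And>\<omega>. \<omega> \<in> space M \<Longrightarrow> countable {u. (u, \<omega>) \<in> D}"
    and B: "B \<in> sets borel"
  shows "(\<lambda>\<omega>. \<integral>\<^sup>+ u. indicator D (u, \<omega>) * emeasure (\<nu> \<omega>) ({u} \<times> B) \<partial>count_space {0..t})
    \<in> borel_measurable M"
proof -
  have "(\<lambda>\<omega>. (t, \<omega>)) \<in> M \<rightarrow>\<^sub>M predictable_sigma_on M F t"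
    using t by (intro measurable_graph_predictable) auto
  from measurable_compose[OF this compensator_integral_predictable[OF D(1) B]]
  have "(\<lambda>\<omega>. \<integral>\<^sup>+ (u, x). indicator D (u, \<omega>) * indicator B x * indicator {0..t} u \<partial>\<nu> \<omega>)
    \<in> borel_measurable M" by simp
  moreover have "(\<integral>\<^sup>+ (u, x). indicator D (u, \<omega>) * indicator B x * indicator {0..t} u \<partial>\<nu> \<omega>) =
    (\<integral>\<^sup>+ u. indicator D (u, \<omega>) * emeasure (\<nu> \<omega>) ({u} \<times> B) \<partial>count_space {0..t})"
    if \<omega>: "\<omega> \<in> space M" for \<omega>
  proof -
    let ?E = "{u. (u, \<omega>) \<in> D}"
    have ind: "indicator D (u, \<omega>) = (indicator ?E u :: ennreal)" for u
      by (simp add: indicator_def)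
    have "(\<integral>\<^sup>+ (u, x). indicator D (u, \<omega>) * indicator B x * indicator {0..t} u \<partial>\<nu> \<omega>) =
      (\<integral>\<^sup>+ (u, x). indicator ?E u * indicator B x \<partial>\<nu> \<omega>)"
      using section_subset[OF D(1), of \<omega>]
      by (intro nn_integral_cong) (auto simp: indicator_def split: prod.splits)
    also have "\<dots> = (\<integral>\<^sup>+ u. indicator ?E u * emeasure (\<nu> \<omega>) ({u} \<times> B) \<partial>count_space {0..t})"
      using \<omega> D B by (intro nn_integral_countable_times sets_compensator section_subset) auto
    finally show ?thesis by (simp add: ind)
  qed
  ultimately show ?thesis by (subst measurable_cong[symmetric]) auto
qed

end

text \<open>
  On the graph of one of the exhausting times the atom is the value at \<open>s\<close> of the integral process
  of that graph; off all of these graphs it vanishes.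
\<close>

lemma compensator_atom_predictable:
  assumes jc: "jump_compensator M F t X \<nu>" and t: "0 \<le> t" and B: "B \<in> sets borel"
  shows "(\<lambda>(s, \<omega>). emeasure (\<nu> \<omega>) ({s} \<times> B)) \<in> borel_measurable (predictable_sigma_on M F t)"
proof -
  let ?A = "atom_set M t \<nu>"
  have comp: "predictable_compensator M F t (jump_measure t X) \<nu>"
    using jc by (simp add: jump_compensator_def)
  obtain T :: "nat \<Rightarrow> 'a \<Rightarrow> ennreal" where T: "\<And>m. predictable_stopping_time M F (T m)"
    and A: "?A = (\<Union>m. stopping_time_graph M (T m))"
    using jc unfolding jump_compensator_def thin_exhausted_by_predictable_def by auto
  let ?G = "\<lambda>m. stopping_time_graph M (T m)"
  have G: "?G m \<in> sets (predictable_sigma_on M F t)" for m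
  proof -
    have "?G m \<subseteq> ?A" using A by auto
    then show ?thesis
      using stopping_time_graph_predictable[OF T] t
      by (auto simp: sets_predictable_sigma_on_iff atom_set_def)
  qed
  define H where "H m = (\<lambda>z. indicator (?G m) z *
    (case z of (s, \<omega>) \<Rightarrow> \<integral>\<^sup>+ (u, x). indicator (?G m) (u, \<omega>) * indicator B x * indicator {0..s} u \<partial>\<nu> \<omega>))" for m
  have "H m \<in> borel_measurable (predictable_sigma_on M F t)" for m
    unfolding H_def using compensator_integral_predictable[OF t comp G B] G
    by (intro borel_measurable_times_ennreal) auto
  then have meas: "(\<lambda>z. SUP m. H m z) \<in> borel_measurable (predictable_sigma_on M F t)"
    by (intro borel_measurable_SUP) auto
  have H: "H m (s, \<omega>) = indicator (?G m) (s, \<omega>) * emeasure (\<nu> \<omega>) ({s} \<times> B)"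
    if s: "s \<in> {0..t}" "\<omega> \<in> space M" for m s \<omega>
  proof (cases "(s, \<omega>) \<in> ?G m")
    case True
    have "{u. (u, \<omega>) \<in> ?G m} = {s}" using True by (auto simp: stopping_time_graph_def)
    then have "(u, \<omega>) \<in> ?G m \<longleftrightarrow> u = s" for u by auto
    then have "(\<integral>\<^sup>+ (u, x). indicator (?G m) (u, \<omega>) * indicator B x * indicator {0..s} u \<partial>\<nu> \<omega>)
      = (\<integral>\<^sup>+ z. indicator ({s} \<times> B) z \<partial>\<nu> \<omega>)"
      using s by (intro nn_integral_cong) (auto simp: indicator_def split: prod.splits)
    also have "\<dots> = emeasure (\<nu> \<omega>) ({s} \<times> B)"
      using borel_times_in_jump_space[of "{s}" t B] s B sets_compensator[OF t comp s(2)] by simp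
    finally show ?thesis by (simp add: H_def)
  qed (simp add: H_def)
  have "(SUP m. H m (s, \<omega>)) = emeasure (\<nu> \<omega>) ({s} \<times> B)"
    if s: "s \<in> {0..t}" "\<omega> \<in> space M" for s \<omega>
  proof (cases "\<exists>m. (s, \<omega>) \<in> ?G m")
    case True
    then obtain m where "(s, \<omega>) \<in> ?G m" by auto
    show ?thesis
    proof (rule antisym)
      show "(SUP m. H m (s, \<omega>)) \<le> emeasure (\<nu> \<omega>) ({s} \<times> B)"
        by (intro SUP_least) (auto simp: H[OF s] indicator_def)
      show "emeasure (\<nu> \<omega>) ({s} \<times> B) \<le> (SUP m. H m (s, \<omega>))"
        using \<open>(s, \<omega>) \<in> ?G m\<close> by (intro SUP_upper2[of m]) (auto simp: H[OF s])
    qed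
  next
    case False
    then have "(s, \<omega>) \<notin> ?A" using A by auto
    then have "emeasure (\<nu> \<omega>) ({s} \<times> UNIV) = 0" using s by (auto simp: atom_set_def)
    moreover have "emeasure (\<nu> \<omega>) ({s} \<times> B) \<le> emeasure (\<nu> \<omega>) ({s} \<times> UNIV)"
      using borel_times_in_jump_space[of "{s}" t UNIV] s sets_compensator[OF t comp s(2)]
      by (intro emeasure_mono) auto
    ultimately show ?thesis using False by (simp add: H[OF s])
  qed
  then show ?thesis
    by (intro measurable_cong[THEN iffD1, OF _ meas]) (auto simp: space_predictable_sigma_on)
qed

text \<open>
  The random time is approximated on a grid strictly from the left and from the right; the
  increments over the approximating pairs converge to the jump.
\<close>

lemma jump_at_random_time_measurable:
  assumes Y: "adapted_cadlag M F t Y" and t: "0 \<le> t"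
    and \<tau>: "\<tau> \<in> borel_measurable M" "\<And>\<omega>. \<omega> \<in> space M \<Longrightarrow> \<tau> \<omega> \<in> {0..t}"
  shows "(\<lambda>\<omega>. jump Y (\<tau> \<omega>) \<omega>) \<in> borel_measurable M"
proof -
  define clip where "clip x = max 0 (min t x)" for x :: real
  define p q where "p j s = clip ((of_int \<lceil>real (Suc j) * s\<rceil> - 1) / real (Suc j))"
    and "q j s = clip ((of_int \<lfloor>real (Suc j) * s\<rfloor> + 1) / real (Suc j))" for j s
  have Ym: "Y (clip x) \<in> borel_measurable M" for x
  proof -
    have "clip x \<in> {0..t}" using t by (auto simp: clip_def)
    then have "Y (clip x) \<in> borel_measurable (F (ennreal (clip x)))"
      using Y by (auto simp: adapted_cadlag_def adapted_on_def)
    then show ?thesis by (rule borel_measurable_F_imp_M)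
  qed
  have "(\<lambda>\<omega>. Y (p j (\<tau> \<omega>)) \<omega>) \<in> borel_measurable M" for j
    unfolding p_def
    by (rule measurable_compose_countable'[where f="\<lambda>i \<omega>. Y (clip ((of_int i - 1) / real (Suc j))) \<omega>"
        and g="\<lambda>\<omega>. \<lceil>real (Suc j) * \<tau> \<omega>\<rceil>" and I=UNIV]) (use \<tau>(1) Ym in measurable)
  moreover have "(\<lambda>\<omega>. Y (q j (\<tau> \<omega>)) \<omega>) \<in> borel_measurable M" for j
    unfolding q_def
    by (rule measurable_compose_countable'[where f="\<lambda>i \<omega>. Y (clip ((of_int i + 1) / real (Suc j))) \<omega>"
        and g="\<lambda>\<omega>. \<lfloor>real (Suc j) * \<tau> \<omega>\<rfloor>" and I=UNIV]) (use \<tau>(1) Ym in measurable)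
  ultimately have meas: "(\<lambda>\<omega>. if \<tau> \<omega> \<le> 0 then 0 else Y (q j (\<tau> \<omega>)) \<omega> - Y (p j (\<tau> \<omega>)) \<omega>) \<in> borel_measurable M" for j
    using \<tau>(1) by measurable
  show ?thesis
  proof (rule borel_measurable_LIMSEQ_real[OF _ meas])
    fix \<omega> assume \<omega>: "\<omega> \<in> space M"
    show "(\<lambda>j. if \<tau> \<omega> \<le> 0 then 0 else Y (q j (\<tau> \<omega>)) \<omega> - Y (p j (\<tau> \<omega>)) \<omega>) \<longlonglongrightarrow> jump Y (\<tau> \<omega>) \<omega>"
    proof (cases "\<tau> \<omega> \<le> 0")
      case True
      then show ?thesis by (simp add: jump_def)
    next
      case False
      define s where "s = \<tau> \<omega>"
      have s: "0 < s" "s \<le> t" using False \<tau>(2)[OF \<omega>] by (auto simp: s_def)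
      have pq: "0 \<le> p j s" "p j s < s" "s - 1 / real (Suc j) \<le> p j s"
        "s \<le> q j s" "q j s \<le> t" "q j s \<le> s + 1 / real (Suc j)" for j
      proof -
        define n where "n = real (Suc j)"
        have n: "n > 0" by (simp add: n_def)
        have "of_int \<lceil>n * s\<rceil> - 1 < n * s" "n * s \<le> of_int \<lceil>n * s\<rceil>"
          "of_int \<lfloor>n * s\<rfloor> \<le> n * s" "n * s < of_int \<lfloor>n * s\<rfloor> + 1" by linarith+
        then have *: "(of_int \<lceil>n * s\<rceil> - 1) / n < s" "s - 1 / n \<le> (of_int \<lceil>n * s\<rceil> - 1) / n"
          "(of_int \<lfloor>n * s\<rfloor> + 1) / n \<le> s + 1 / n" "s < (of_int \<lfloor>n * s\<rfloor> + 1) / n"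
          using n by (simp_all add: field_simps)
        show "0 \<le> p j s" "p j s < s" "s - 1 / real (Suc j) \<le> p j s"
          "s \<le> q j s" "q j s \<le> t" "q j s \<le> s + 1 / real (Suc j)"
          using * s n unfolding p_def q_def clip_def n_def[symmetric] by auto
      qed
      have "(\<lambda>j. Y (q j s) \<omega> - Y (p j s) \<omega>) \<longlonglongrightarrow> path_jump (\<lambda>u. Y u \<omega>) s"
      proof (rule tendstoI)
        fix \<eta> :: real assume "\<eta> > 0"
        have cad: "cadlag_on t (\<lambda>u. Y u \<omega>)" using Y \<omega> by (auto simp: adapted_cadlag_def)
        obtain d where d: "d > 0"
          "\<And>p q. \<lbrakk>0 \<le> p; p \<le> q; q \<le> t; \<bar>p - s\<bar> < d; \<bar>q - s\<bar> < d; p < s; s \<le> q\<rbrakk>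
           \<Longrightarrow> \<bar>Y q \<omega> - Y p \<omega> - path_jump (\<lambda>u. Y u \<omega>) s\<bar> < \<eta>"
          by (rule cadlag_on_increments_near[OF cad, of s \<eta>]) (use s \<open>\<eta> > 0\<close> in auto)
        have "(\<lambda>j. 1 / real (Suc j)) \<longlonglongrightarrow> 0"
          using LIMSEQ_inverse_real_of_nat by (simp add: divide_inverse)
        then have "\<forall>\<^sub>F j in sequentially. 1 / real (Suc j) < d"
          using d(1) by (rule order_tendstoD(2))
        then show "\<forall>\<^sub>F j in sequentially. dist (Y (q j s) \<omega> - Y (p j s) \<omega>) (path_jump (\<lambda>u. Y u \<omega>) s) < \<eta>"
        proof eventually_elim
          case (elim j)
          have "p j s \<le> q j s" "\<bar>p j s - s\<bar> < d" "\<bar>q j s - s\<bar> < d"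
            using pq[of j] elim by linarith+
          then show ?case unfolding dist_real_def using pq[of j] by (intro d(2)) auto
        qed
      qed
      then show ?thesis using False by (simp add: s_def jump_eq_path_jump)
    qed
  qed
qed

text \<open>
  On a thin set the sum over all times is a series over the exhausting stopping times, whose terms are
  values of the jump process at random times.
\<close>

lemma jump_sum_measurable:
  assumes Y: "adapted_cadlag M F t Y" and t: "0 \<le> t"
    and D: "D \<in> sets (predictable_sigma_on M F t)" "D \<subseteq> A" "thin_exhausted_by_predictable M F A"
    and B: "B \<in> sets borel"
  shows "(\<lambda>\<omega>. \<integral>\<^sup>+ u. indicator D (u, \<omega>) * indicator B (jump Y u \<omega>) \<partial>count_space {0..t})
    \<in> borel_measurable M"
proof -
  obtain T :: "nat \<Rightarrow> 'a \<Rightarrow> ennreal" where T: "\<And>m. predictable_stopping_time M F (T m)"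
    and A: "A = (\<Union>m. stopping_time_graph M (T m))"
    and disj: "disjoint_family (\<lambda>m. stopping_time_graph M (T m))"
    using D(3) unfolding thin_exhausted_by_predictable_def by auto
  let ?G = "\<lambda>m. stopping_time_graph M (T m)"
  have Tm [measurable]: "T m \<in> borel_measurable M" for m
    using T[of m] sets_F_subset space_F
    by (intro measurable_stopping_time[of F]) (auto simp: predictable_stopping_time_def)
  define \<tau> where "\<tau> m \<omega> = min t (enn2real (T m \<omega>))" for m \<omega>
  have \<tau>m [measurable]: "\<tau> m \<in> borel_measurable M" for m unfolding \<tau>_def by measurable
  have \<tau>_in: "\<tau> m \<omega> \<in> {0..t}" for m \<omega> using t by (auto simp: \<tau>_def)
  define f where "f u \<omega> = (indicator D (u, \<omega>) * indicator B (jump Y u \<omega>) :: ennreal)" for u \<omega>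
  define h where "h m \<omega> = (if T m \<omega> \<le> ennreal t then f (\<tau> m \<omega>) \<omega> else 0)" for m \<omega>
  have "h m \<in> borel_measurable M" for m
  proof -
    have [measurable]: "(\<lambda>\<omega>. indicator D (\<tau> m \<omega>, \<omega>) :: ennreal) \<in> borel_measurable M"
      using measurable_compose[OF measurable_graph_predictable[OF \<tau>m[of m] \<tau>_in]
          borel_measurable_indicator[OF D(1)]] .
    have [measurable]: "(\<lambda>\<omega>. jump Y (\<tau> m \<omega>) \<omega>) \<in> borel_measurable M"
      by (rule jump_at_random_time_measurable[OF Y t \<tau>m \<tau>_in])
    note B[measurable]
    show ?thesis unfolding h_def f_def by measurable
  qed
  then have meas: "(\<lambda>\<omega>. \<Sum>m. h m \<omega>) \<in> borel_measurable M" by measurable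
  have "(\<integral>\<^sup>+ u. f u \<omega> \<partial>count_space {0..t}) = (\<Sum>m. h m \<omega>)" if \<omega>: "\<omega> \<in> space M" for \<omega>
  proof -
    have "f u \<omega> = (\<Sum>m. indicator (?G m) (u, \<omega>) * f u \<omega>)" for u
    proof (cases "(u, \<omega>) \<in> D")
      case True
      then obtain m where m: "(u, \<omega>) \<in> ?G m" using D(2) A by auto
      have "indicator (?G i) (u, \<omega>) * f u \<omega> = (if i = m then f u \<omega> else 0)" for i
        using m disj by (auto simp: disjoint_family_on_def indicator_def)
      then show ?thesis using sums_unique[OF sums_single[of m "\<lambda>_. f u \<omega>"]] by simp
    qed (simp add: f_def)
    then have "(\<integral>\<^sup>+ u. f u \<omega> \<partial>count_space {0..t}) =
      (\<integral>\<^sup>+ u. (\<Sum>m. indicator (?G m) (u, \<omega>) * f u \<omega>) \<partial>count_space {0..t})" by simp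
    also have "\<dots> = (\<Sum>m. \<integral>\<^sup>+ u. indicator (?G m) (u, \<omega>) * f u \<omega> \<partial>count_space {0..t})"
      by (rule nn_integral_suminf) simp
    also have "\<dots> = (\<Sum>m. h m \<omega>)"
    proof (rule arg_cong[where f=suminf], rule ext)
      fix m
      show "(\<integral>\<^sup>+ u. indicator (?G m) (u, \<omega>) * f u \<omega> \<partial>count_space {0..t}) = h m \<omega>"
      proof (cases "T m \<omega> \<le> ennreal t")
        case True
        then obtain a where a: "T m \<omega> = ennreal a" "0 \<le> a" "a \<le> t"
          using t by (cases "T m \<omega>") (auto simp: top_unique ennreal_le_iff)
        have "\<tau> m \<omega> = a" using a by (simp add: \<tau>_def)
        have "indicator (?G m) (u, \<omega>) = (indicator {a} u :: ennreal)" if "u \<in> {0..t}" for u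
          using that a \<omega> by (auto simp: stopping_time_graph_def indicator_def)
        then have "(\<integral>\<^sup>+ u. indicator (?G m) (u, \<omega>) * f u \<omega> \<partial>count_space {0..t}) =
          (\<integral>\<^sup>+ u. f u \<omega> * indicator {a} u \<partial>count_space {0..t})"
          by (intro nn_integral_cong) (simp add: mult.commute)
        also have "\<dots> = f a \<omega>"
          using a by (subst nn_integral_indicator_singleton) auto
        finally show ?thesis using True \<open>\<tau> m \<omega> = a\<close> by (simp add: h_def)
      next
        case False
        then have "indicator (?G m) (u, \<omega>) = (0 :: ennreal)" if "u \<in> {0..t}" for u
          using that by (auto simp: stopping_time_graph_def indicator_def ennreal_leI)
        then have "(\<integral>\<^sup>+ u. indicator (?G m) (u, \<omega>) * f u \<omega> \<partial>count_space {0..t}) =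
          (\<integral>\<^sup>+ u. 0 \<partial>count_space {0..t})"
          by (intro nn_integral_cong) simp
        then show ?thesis using False by (simp add: h_def)
      qed
    qed
    finally show ?thesis .
  qed
  then show ?thesis
    unfolding f_def[symmetric] by (intro measurable_cong[THEN iffD2, OF _ meas]) auto
qed

text \<open>
  The expected number of jumps at the times of \<open>A\<close> that are no atoms of the compensator equals the
  expected compensator mass of these times, which is zero.
\<close>

lemma AE_no_jump_off_atoms:
  assumes Y: "adapted_cadlag M F t Y" and t: "0 \<le> t" and jc: "jump_compensator M F t Y \<nu>"
    and A: "A \<in> sets (predictable_sigma_on M F t)" "thin_exhausted_by_predictable M F A"
  shows "AE \<omega> in M. \<forall>s. (s, \<omega>) \<in> A \<longrightarrow> jump Y s \<omega> \<noteq> 0 \<longrightarrow> (s, \<omega>) \<in> atom_set M t \<nu>"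
proof -
  have comp: "predictable_compensator M F t (jump_measure t Y) \<nu>"
    using jc by (simp add: jump_compensator_def)
  define D where "D = A - atom_set M t \<nu>"
  let ?B = "UNIV - {0::real}"
  let ?h = "\<lambda>\<omega>. \<integral>\<^sup>+ u. indicator D (u, \<omega>) * indicator ?B (jump Y u \<omega>) \<partial>count_space {0..t} :: ennreal"
  have D: "D \<in> sets (predictable_sigma_on M F t)"
    unfolding D_def using A(1) atom_set_predictable[OF jc t] by auto
  have cD: "countable {u. (u, \<omega>) \<in> D}" for \<omega>
    by (rule countable_subset[OF _ thin_countable_sections[OF A(2), of \<omega>]]) (auto simp: D_def)
  have "indicator D (u, \<omega>) * emeasure (\<nu> \<omega>) ({u} \<times> ?B) = 0" if \<omega>: "\<omega> \<in> space M" and u: "u \<in> {0..t}" for u \<omega>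
  proof (cases "(u, \<omega>) \<in> D")
    case True
    then have "emeasure (\<nu> \<omega>) ({u} \<times> UNIV) = 0" using \<omega> u by (auto simp: D_def atom_set_def)
    moreover have "emeasure (\<nu> \<omega>) ({u} \<times> ?B) \<le> emeasure (\<nu> \<omega>) ({u} \<times> UNIV)"
      using borel_times_in_jump_space[of "{u}" t UNIV] u sets_compensator[OF t comp \<omega>]
      by (intro emeasure_mono) auto
    ultimately show ?thesis by simp
  qed simp
  then have "(\<integral>\<^sup>+ \<omega>. (\<integral>\<^sup>+ u. indicator D (u, \<omega>) * emeasure (\<nu> \<omega>) ({u} \<times> ?B) \<partial>count_space {0..t}) \<partial>M)
    = (\<integral>\<^sup>+ \<omega>. (\<integral>\<^sup>+ u. 0 \<partial>count_space {0..t}) \<partial>M)"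
    by (intro nn_integral_cong) auto
  then have "(\<integral>\<^sup>+ \<omega>. ?h \<omega> \<partial>M) = 0"
    using compensator_identity[OF t comp D cD, of ?B] by simp
  moreover have "?h \<in> borel_measurable M"
    by (rule jump_sum_measurable[OF Y t D _ A(2)]) (auto simp: D_def)
  ultimately have "AE \<omega> in M. ?h \<omega> = 0" by (simp add: nn_integral_0_iff_AE)
  then show ?thesis
  proof (rule AE_mp, intro AE_I2 impI allI)
    fix \<omega> s assume \<omega>: "\<omega> \<in> space M" "?h \<omega> = 0" and s: "(s, \<omega>) \<in> A" "jump Y s \<omega> \<noteq> 0"
    have "s \<in> {0..t}" using section_subset[OF A(1), of \<omega>] s(1) by (auto simp: subset_eq)
    moreover from \<omega>(2) have "\<forall>u\<in>{0..t}. indicator D (u, \<omega>) * indicator ?B (jump Y u \<omega>) = (0::ennreal)"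
      by (simp add: nn_integral_0_iff_AE AE_count_space)
    ultimately have "(s, \<omega>) \<notin> D" using s by (auto simp: indicator_def split: if_splits)
    then show "(s, \<omega>) \<in> atom_set M t \<nu>" using s by (simp add: D_def)
  qed
qed

end

section \<open>A uniform bound for the atoms of many compensators\<close>

context usual_filtered_prob_space
begin

text \<open>
  Up to the stopping time, all the jumps into \<open>B\<close> of all the processes sit on a random set of at
  most \<open>q\<close> times. The space splits into disjoint predictable sets according to which of the first
  \<open>m\<close> compensators has the largest atom; on each piece the atom of that compensator has the same
  expectation as the number of jumps of its process, and these pieces together count at most \<open>q\<close>
  jumps. This bound is uniform in \<open>m\<close>.
\<close>

lemma AE_sum_SUP_atoms_finite:
  fixes Z :: "nat \<Rightarrow> real \<Rightarrow> 'a \<Rightarrow> real"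
  assumes t: "0 \<le> t" and Z: "\<And>i. adapted_cadlag M F t (Z i)"
    and jc: "\<And>i. jump_compensator M F t (Z i) (N i)"
    and \<theta>: "stopping_time F \<theta>" and B: "B \<in> sets borel" "0 \<notin> B"
    and dom: "\<And>i \<omega> u. \<omega> \<in> space M \<Longrightarrow> u \<in> {0..t} \<Longrightarrow> ennreal u \<le> \<theta> \<omega> \<Longrightarrow> jump (Z i) u \<omega> \<in> B \<Longrightarrow> u \<in> S \<omega>"
    and S: "\<And>\<omega>. \<omega> \<in> space M \<Longrightarrow> finite (S \<omega>) \<and> card (S \<omega>) \<le> q"
  shows "AE \<omega> in M. (\<integral>\<^sup>+ u. indicator {u. ennreal u \<le> \<theta> \<omega>} u *
    (SUP i. emeasure (N i \<omega>) ({u} \<times> B)) \<partial>count_space {0..t}) < \<infinity>"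
proof -
  let ?P = "predictable_sigma_on M F t"
  define a where "a i z = (case z of (u, \<omega>) \<Rightarrow> emeasure (N i \<omega>) ({u} \<times> B))" for i and z :: "real \<times> 'a"
  have a_meas [measurable]: "a i \<in> borel_measurable ?P" for i
    unfolding a_def using compensator_atom_predictable[OF jc t B(1)] .
  have comp: "predictable_compensator M F t (jump_measure t (Z i)) (N i)" for i
    using jc[of i] unfolding jump_compensator_def by (elim conjE)
  have thin: "thin_exhausted_by_predictable M F (atom_set M t (N i))" for i
    using jc[of i] unfolding jump_compensator_def by (elim conjE)
  define I where "I = {(u, \<omega>). u \<in> {0..t} \<and> \<omega> \<in> space M \<and> ennreal u \<le> \<theta> \<omega>}"
  have I: "I \<in> sets ?P"
  proof -
    have "I = {(s, \<omega>). 0 \<le> s \<and> \<omega> \<in> space M \<and> ennreal s \<le> \<theta> \<omega>} \<inter> ({0..t} \<times> space M)"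
      by (auto simp: I_def)
    then have "I \<in> sets (predictable_sigma M F)"
      using predictable_stochastic_interval[OF \<theta>] Icc_times_space_predictable[OF t] by auto
    moreover have "I \<subseteq> {0..t} \<times> space M" by (auto simp: I_def)
    ultimately show ?thesis by (simp add: sets_predictable_sigma_on_iff[OF t])
  qed
  \<comment> \<open>\<open>i\<close> is the first index in \<open>{..m}\<close> at which the atom is largest\<close>
  define E where "E m i = {z \<in> space ?P. (\<forall>j\<in>{..m}. a j z \<le> a i z) \<and> (\<forall>j\<in>{..<i}. a j z < a i z)}" for m i
  define D where "D m i = atom_set M t (N i) \<inter> I \<inter> E m i" for m i
  have D: "D m i \<in> sets ?P" for m i
    unfolding D_def
  proof (intro sets.Int I atom_set_predictable[OF jc t])
    show "E m i \<in> sets ?P" unfolding E_def by measurable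
  qed
  have cD: "countable {u. (u, \<omega>) \<in> D m i}" for m i \<omega>
    by (rule countable_subset[OF _ thin_countable_sections[OF thin[of i], of \<omega>]]) (auto simp: D_def)
  have disj: "i = j" if "z \<in> D m i" "z \<in> D m j" "i \<le> m" "j \<le> m" for i j m z
  proof (rule ccontr)
    assume "i \<noteq> j"
    then consider "i < j" | "j < i" by linarith
    then show False
      using that unfolding D_def E_def by cases (auto simp: not_le[symmetric])
  qed
  define g where "g m u \<omega> = indicator I (u, \<omega>) * (SUP i\<in>{..m}. a i (u, \<omega>))" for m u \<omega>
  have g_eq: "g m u \<omega> = (\<Sum>i\<le>m. indicator (D m i) (u, \<omega>) * a i (u, \<omega>))"
    if u: "u \<in> {0..t}" "\<omega> \<in> space M" for m u \<omega>
  proof (cases "(u, \<omega>) \<in> I")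
    case False
    then show ?thesis by (simp add: g_def D_def)
  next
    case True
    define s where "s = (SUP i\<in>{..m}. a i (u, \<omega>))"
    have le_s: "a i (u, \<omega>) \<le> s" if "i \<le> m" for i
      unfolding s_def using that by (intro SUP_upper) auto
    have "s = Max ((\<lambda>i. a i (u, \<omega>)) ` {..m})"
      unfolding s_def by (intro cSup_eq_Max) auto
    also have "\<dots> \<in> (\<lambda>i. a i (u, \<omega>)) ` {..m}" by (intro Max_in) auto
    finally have ex: "\<exists>i. i \<le> m \<and> a i (u, \<omega>) = s" by auto
    define i0 where "i0 = (LEAST i. i \<le> m \<and> a i (u, \<omega>) = s)"
    have i0: "i0 \<le> m" "a i0 (u, \<omega>) = s" using LeastI_ex[OF ex] by (auto simp: i0_def)
    have least: "\<not> (i \<le> m \<and> a i (u, \<omega>) = s)" if "i < i0" for i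
      using not_less_Least that unfolding i0_def by blast
    show ?thesis
    proof (cases "s = 0")
      case True
      then have "a i (u, \<omega>) = 0" if "i \<le> m" for i using le_s[OF that] by simp
      then have "(\<Sum>i\<le>m. indicator (D m i) (u, \<omega>) * a i (u, \<omega>)) = 0" by simp
      then show ?thesis using True by (simp add: g_def s_def)
    next
      case False
      have "(u, \<omega>) \<in> atom_set M t (N i0)"
      proof -
        have "emeasure (N i0 \<omega>) ({u} \<times> B) \<le> emeasure (N i0 \<omega>) ({u} \<times> UNIV)"
          using borel_times_in_jump_space[of "{u}" t UNIV] u sets_compensator[OF t comp u(2)]
          by (intro emeasure_mono) auto
        moreover have "0 < emeasure (N i0 \<omega>) ({u} \<times> B)"
          using False i0(2) by (simp add: a_def zero_less_iff_neq_zero)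
        ultimately show ?thesis using u by (auto simp: atom_set_def)
      qed
      moreover have "(u, \<omega>) \<in> E m i0"
      proof -
        have "a j (u, \<omega>) < a i0 (u, \<omega>)" if "j < i0" for j
          using le_s[of j] least[OF that] that i0 by (simp add: less_le)
        then show ?thesis
          using u le_s i0(2) by (simp add: E_def space_predictable_sigma_on)
      qed
      ultimately have in_D: "(u, \<omega>) \<in> D m i0" using True by (simp add: D_def)
      have "(\<Sum>i\<le>m. indicator (D m i) (u, \<omega>) * a i (u, \<omega>)) = (\<Sum>i\<le>m. if i = i0 then s else 0)"
      proof (rule sum.cong[OF refl])
        fix i assume "i \<in> {..m}"
        then have "(u, \<omega>) \<notin> D m i" if "i \<noteq> i0" using disj[OF in_D _ i0(1), of i] that by blast
        then show "indicator (D m i) (u, \<omega>) * a i (u, \<omega>) = (if i = i0 then s else 0)"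
          using in_D i0 by (cases "i = i0") simp_all
      qed
      also have "\<dots> = s" using i0 by simp
      finally show ?thesis using True by (simp add: g_def s_def)
    qed
  qed
  have g_int: "(\<integral>\<^sup>+ u. g m u \<omega> \<partial>count_space {0..t}) =
      (\<Sum>i\<le>m. \<integral>\<^sup>+ u. indicator (D m i) (u, \<omega>) * emeasure (N i \<omega>) ({u} \<times> B) \<partial>count_space {0..t})"
    if "\<omega> \<in> space M" for m \<omega>
  proof -
    have "(\<integral>\<^sup>+ u. g m u \<omega> \<partial>count_space {0..t}) =
      (\<integral>\<^sup>+ u. (\<Sum>i\<le>m. indicator (D m i) (u, \<omega>) * a i (u, \<omega>)) \<partial>count_space {0..t})"
      using that by (intro nn_integral_cong) (simp add: g_eq)
    also have "\<dots> = (\<Sum>i\<le>m. \<integral>\<^sup>+ u. indicator (D m i) (u, \<omega>) * a i (u, \<omega>) \<partial>count_space {0..t})"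
      by (rule nn_integral_sum) simp
    finally show ?thesis by (simp add: a_def)
  qed
  have part_meas: "(\<lambda>\<omega>. \<integral>\<^sup>+ u. indicator (D m i) (u, \<omega>) * emeasure (N i \<omega>) ({u} \<times> B) \<partial>count_space {0..t})
      \<in> borel_measurable M" for m i
    by (rule compensator_sum_measurable[OF t comp D cD B(1)])
  have g_meas: "(\<lambda>\<omega>. \<integral>\<^sup>+ u. g m u \<omega> \<partial>count_space {0..t}) \<in> borel_measurable M" for m
    by (subst measurable_cong[OF g_int]) (auto intro!: borel_measurable_sum part_meas)
  have bound: "(\<integral>\<^sup>+ \<omega>. (\<integral>\<^sup>+ u. g m u \<omega> \<partial>count_space {0..t}) \<partial>M) \<le> of_nat q" for m
  proof -
    let ?J = "\<lambda>i u \<omega>. indicator (D m i) (u, \<omega>) * indicator B (jump (Z i) u \<omega>) :: ennreal"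
    have J_meas: "(\<lambda>\<omega>. \<integral>\<^sup>+ u. ?J i u \<omega> \<partial>count_space {0..t}) \<in> borel_measurable M" for i
      by (rule jump_sum_measurable[OF Z t D _ thin[of i] B(1)]) (auto simp: D_def)
    have "(\<integral>\<^sup>+ \<omega>. (\<integral>\<^sup>+ u. g m u \<omega> \<partial>count_space {0..t}) \<partial>M) =
      (\<integral>\<^sup>+ \<omega>. (\<Sum>i\<le>m. \<integral>\<^sup>+ u. indicator (D m i) (u, \<omega>) * emeasure (N i \<omega>) ({u} \<times> B) \<partial>count_space {0..t}) \<partial>M)"
      by (intro nn_integral_cong g_int)
    also have "\<dots> = (\<Sum>i\<le>m. \<integral>\<^sup>+ \<omega>. (\<integral>\<^sup>+ u. indicator (D m i) (u, \<omega>) * emeasure (N i \<omega>) ({u} \<times> B) \<partial>count_space {0..t}) \<partial>M)"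
      by (intro nn_integral_sum part_meas)
    also have "\<dots> = (\<Sum>i\<le>m. \<integral>\<^sup>+ \<omega>. (\<integral>\<^sup>+ u. ?J i u \<omega> \<partial>count_space {0..t}) \<partial>M)"
      by (intro sum.cong refl compensator_identity[OF t comp D cD B])
    also have "\<dots> = (\<integral>\<^sup>+ \<omega>. (\<Sum>i\<le>m. \<integral>\<^sup>+ u. ?J i u \<omega> \<partial>count_space {0..t}) \<partial>M)"
      by (rule nn_integral_sum[symmetric]) (rule J_meas)
    also have "\<dots> = (\<integral>\<^sup>+ \<omega>. (\<integral>\<^sup>+ u. (\<Sum>i\<le>m. ?J i u \<omega>) \<partial>count_space {0..t}) \<partial>M)"
      by (intro nn_integral_cong nn_integral_sum[symmetric]) simp
    also have "\<dots> \<le> (\<integral>\<^sup>+ \<omega>. of_nat q \<partial>M)"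
    proof (rule nn_integral_mono)
      fix \<omega> assume \<omega>: "\<omega> \<in> space M"
      have "(\<Sum>i\<le>m. ?J i u \<omega>) \<le> indicator (S \<omega>) u" if u: "u \<in> {0..t}" for u
      proof (cases "u \<in> S \<omega>")
        case True
        have "(\<Sum>i\<le>m. ?J i u \<omega>) \<le> (\<Sum>i\<le>m. indicator (D m i) (u, \<omega>))"
          by (intro sum_mono) (simp add: indicator_def)
        also have "\<dots> = indicator (\<Union>i\<le>m. D m i) (u, \<omega>)"
        proof (rule indicator_UN_disjoint[symmetric])
          show "disjoint_family_on (D m) {..m}"
            unfolding disjoint_family_on_def using disj by blast
        qed simp
        also have "\<dots> \<le> 1" by (simp add: indicator_def)
        finally show ?thesis using True by simp
      next
        case False
        have "?J i u \<omega> = 0" for i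
          using False dom[OF \<omega> u, of i] by (auto simp: indicator_def D_def I_def)
        then have "(\<Sum>i\<le>m. ?J i u \<omega>) = 0" by (intro sum.neutral) blast
        then show ?thesis by simp
      qed
      then have "(\<integral>\<^sup>+ u. (\<Sum>i\<le>m. ?J i u \<omega>) \<partial>count_space {0..t}) \<le>
        (\<integral>\<^sup>+ u. indicator (S \<omega>) u \<partial>count_space {0..t})"
        by (intro nn_integral_mono) simp
      also have "\<dots> = emeasure (count_space {0..t}) (S \<omega> \<inter> {0..t})"
        using nn_integral_indicator'[of "S \<omega>" "count_space {0..t}"] by (simp del: nn_integral_indicator')
      also have "\<dots> = of_nat (card (S \<omega> \<inter> {0..t}))"
        using S[OF \<omega>] by (intro emeasure_count_space_finite) auto
      also have "\<dots> \<le> of_nat (card (S \<omega>))" using S[OF \<omega>] by (auto intro!: card_mono)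
      also have "\<dots> \<le> of_nat q" using S[OF \<omega>] by simp
      finally show "(\<integral>\<^sup>+ u. (\<Sum>i\<le>m. ?J i u \<omega>) \<partial>count_space {0..t}) \<le> of_nat q" .
    qed
    also have "\<dots> = of_nat q" by (simp add: emeasure_space_1)
    finally show ?thesis .
  qed
  have g_mono: "g m u \<omega> \<le> g m' u \<omega>" if "m \<le> m'" for m m' u \<omega>
    unfolding g_def using that by (intro mult_left_mono SUP_subset_mono) auto
  have inc: "incseq (\<lambda>m u. g m u \<omega>)" for \<omega>
    by (auto simp: incseq_def le_fun_def intro: g_mono)
  define G where "G \<omega> = (SUP m. \<integral>\<^sup>+ u. g m u \<omega> \<partial>count_space {0..t})" for \<omega>
  have G_meas: "G \<in> borel_measurable M"
    unfolding G_def using g_meas by (intro borel_measurable_SUP) auto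
  have "(\<integral>\<^sup>+ \<omega>. G \<omega> \<partial>M) = (SUP m. \<integral>\<^sup>+ \<omega>. (\<integral>\<^sup>+ u. g m u \<omega> \<partial>count_space {0..t}) \<partial>M)"
    unfolding G_def using g_meas
    by (intro nn_integral_monotone_convergence_SUP)
      (auto simp: incseq_def le_fun_def intro!: nn_integral_mono g_mono)
  also have "\<dots> \<le> of_nat q" by (intro SUP_least bound)
  finally have "(\<integral>\<^sup>+ \<omega>. G \<omega> \<partial>M) \<noteq> \<infinity>" by (auto simp: top_unique)
  with G_meas have "AE \<omega> in M. G \<omega> \<noteq> \<infinity>" by (rule nn_integral_PInf_AE)
  then show ?thesis
  proof (rule AE_mp, intro AE_I2 impI)
    fix \<omega> assume \<omega>: "\<omega> \<in> space M" "G \<omega> \<noteq> \<infinity>"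
    have SUP_a: "(SUP m. SUP i\<in>{..m}. a i z) = (SUP i. a i z)" for z
    proof (intro antisym SUP_least)
      show "a i z \<le> (SUP m. SUP i\<in>{..m}. a i z)" for i
        by (rule SUP_upper2[of i]) (auto intro: SUP_upper)
    qed (auto intro: SUP_upper)
    have "(\<integral>\<^sup>+ u. indicator {u. ennreal u \<le> \<theta> \<omega>} u * (SUP i. emeasure (N i \<omega>) ({u} \<times> B)) \<partial>count_space {0..t})
      = (\<integral>\<^sup>+ u. (SUP m. g m u \<omega>) \<partial>count_space {0..t})"
    proof (rule nn_integral_cong)
      fix u assume "u \<in> space (count_space {0..t})"
      then have "indicator I (u, \<omega>) = (indicator {u. ennreal u \<le> \<theta> \<omega>} u :: ennreal)"
        using \<omega> by (auto simp: I_def indicator_def)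
      moreover have "(SUP m. g m u \<omega>) = indicator I (u, \<omega>) * (SUP i. a i (u, \<omega>))"
        unfolding g_def SUP_a[symmetric] by (rule SUP_mult_left_ennreal[symmetric])
      ultimately show "indicator {u. ennreal u \<le> \<theta> \<omega>} u * (SUP i. emeasure (N i \<omega>) ({u} \<times> B)) = (SUP m. g m u \<omega>)"
        by (simp add: a_def)
    qed
    also have "\<dots> = G \<omega>"
      unfolding G_def using inc by (intro nn_integral_monotone_convergence_SUP) auto
    also have "\<dots> < \<infinity>" using \<omega>(2) by (simp add: less_top)
    finally show "(\<integral>\<^sup>+ u. indicator {u. ennreal u \<le> \<theta> \<omega>} u *
      (SUP i. emeasure (N i \<omega>) ({u} \<times> B)) \<partial>count_space {0..t}) < \<infinity>" .
  qed
qed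

end

section \<open>Localising the large jumps\<close>

text \<open>
  Outside the first two of the following events the jumps of \<open>X\<^sup>n\<close>, \<open>n \<ge> l\<close>, that are larger than \<open>L\<close>
  occur at the same times up to \<open>u\<close> as those of \<open>X\<close>; the third event limits the number of these
  times. All of them increase with \<open>u\<close>, so that the hitting time of their union is a stopping time.
\<close>

definition jump_deviation_event ::
    "'a measure \<Rightarrow> (real \<Rightarrow> 'a \<Rightarrow> real) \<Rightarrow> (nat \<Rightarrow> real \<Rightarrow> 'a \<Rightarrow> real) \<Rightarrow> real \<Rightarrow> nat \<Rightarrow> real \<Rightarrow> 'a set" where
  "jump_deviation_event M X Xn c l u =
     {\<omega> \<in> space M. \<exists>n\<ge>l. \<exists>s\<in>{0<..u}. \<bar>jump (Xn n) s \<omega> - jump X s \<omega>\<bar> \<ge> c}"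

definition critical_jump_event ::
    "'a measure \<Rightarrow> (real \<Rightarrow> 'a \<Rightarrow> real) \<Rightarrow> real \<Rightarrow> real \<Rightarrow> real \<Rightarrow> 'a set" where
  "critical_jump_event M X c L u =
     {\<omega> \<in> space M. \<exists>s\<in>{0<..u}. L - c \<le> \<bar>jump X s \<omega>\<bar> \<and> \<bar>jump X s \<omega>\<bar> \<le> L + c}"

definition many_jumps_event ::
    "'a measure \<Rightarrow> (real \<Rightarrow> 'a \<Rightarrow> real) \<Rightarrow> real \<Rightarrow> nat \<Rightarrow> real \<Rightarrow> 'a set" where
  "many_jumps_event M X L q u =
     {\<omega> \<in> space M. q \<le> card {s \<in> {0<..u}. \<bar>jump X s \<omega>\<bar> \<ge> L}}"

definition bad_event ::
    "'a measure \<Rightarrow> (real \<Rightarrow> 'a \<Rightarrow> real) \<Rightarrow> (nat \<Rightarrow> real \<Rightarrow> 'a \<Rightarrow> real) \<Rightarrow> real \<Rightarrow> real \<Rightarrow> nat \<Rightarrow> nat \<Rightarrow> real \<Rightarrow> 'a set" where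
  "bad_event M X Xn c L l q u =
     jump_deviation_event M X Xn c l u \<union> critical_jump_event M X c L u \<union> many_jumps_event M X L q u"

lemma adapted_cadlag_diff:
  assumes "adapted_cadlag M F t X" "adapted_cadlag M F t Y"
  shows "adapted_cadlag M F t (\<lambda>s \<omega>. Y s \<omega> - X s \<omega>)"
  using assms unfolding adapted_cadlag_def adapted_on_def
  by (auto intro!: borel_measurable_diff cadlag_on_diff)

lemma jump_diff:
  assumes "adapted_cadlag M F t X" "adapted_cadlag M F t Y" "\<omega> \<in> space M" "s \<le> t"
  shows "jump (\<lambda>s \<omega>. Y s \<omega> - X s \<omega>) s \<omega> = jump Y s \<omega> - jump X s \<omega>"
  using assms unfolding jump_eq_path_jump adapted_cadlag_def by (intro path_jump_diff) auto

lemma finite_large_jumps: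
  assumes "adapted_cadlag M F t X" "\<omega> \<in> space M" "a > 0" "u \<le> t"
  shows "finite {s \<in> {0<..u}. \<bar>jump X s \<omega>\<bar> \<ge> a}"
proof -
  have "finite {s \<in> {0<..t}. \<bar>jump X s \<omega>\<bar> \<ge> a}"
    unfolding jump_eq_path_jump using assms
    by (intro cadlag_on_finite_large_jumps) (auto simp: adapted_cadlag_def)
  then show ?thesis by (rule finite_subset[rotated]) (use assms in auto)
qed

lemma (in prob_space) prob_tendsto_zero_if_AE_eventually_notin:
  fixes A :: "nat \<Rightarrow> 'a set"
  assumes A: "\<And>k. k \<ge> 1 \<Longrightarrow> A k \<in> sets M" and ev: "AE \<omega> in M. \<forall>\<^sub>F k in sequentially. \<omega> \<notin> A k"
    and "\<epsilon> > 0"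
  shows "\<exists>k0\<ge>1. \<forall>k\<ge>k0. measure M (A k) < \<epsilon>"
proof -
  have "(\<lambda>k. \<integral>\<omega>. indicator (A (Suc k)) \<omega> \<partial>M) \<longlonglongrightarrow> (\<integral>\<omega>. (0::real) \<partial>M)"
  proof (rule integral_dominated_convergence[where w = "\<lambda>_. 1"])
    show "AE \<omega> in M. (\<lambda>k. indicator (A (Suc k)) \<omega> :: real) \<longlonglongrightarrow> 0"
      using ev
    proof eventually_elim
      case (elim \<omega>)
      then have "\<forall>\<^sub>F k in sequentially. \<omega> \<notin> A (Suc k)"
        by (rule eventually_sequentially_Suc[of "\<lambda>k. \<omega> \<notin> A k", THEN iffD2])
      then have "\<forall>\<^sub>F k in sequentially. (indicator (A (Suc k)) \<omega> :: real) = 0"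
        by eventually_elim simp
      then show ?case by (rule tendsto_eventually)
    qed
  qed (use A in \<open>auto simp: indicator_def\<close>)
  moreover have "(\<integral>\<omega>. indicator (A (Suc k)) \<omega> \<partial>M) = measure M (A (Suc k))" for k
    using A[of "Suc k"] sets.sets_into_space[of "A (Suc k)" M] by (simp add: Int_absorb2)
  ultimately have "(\<lambda>k. measure M (A (Suc k))) \<longlonglongrightarrow> 0" by simp
  then have "\<forall>\<^sub>F k in sequentially. measure M (A (Suc k)) < \<epsilon>"
    using \<open>\<epsilon> > 0\<close> by (rule order_tendstoD(2))
  then obtain k0 where k0: "\<And>k. k \<ge> k0 \<Longrightarrow> measure M (A (Suc k)) < \<epsilon>"
    by (auto simp: eventually_sequentially)
  have "measure M (A k) < \<epsilon>" if "k \<ge> Suc k0" for k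
    using k0[of "k - 1"] that by simp
  then show ?thesis by (intro exI[of _ "Suc k0"]) auto
qed

lemma bad_event_mono:
  assumes "adapted_cadlag M F t X" "0 < L" "u \<le> v" "v \<le> t"
  shows "bad_event M X Xn c L l q u \<subseteq> bad_event M X Xn c L l q v"
proof -
  have "q \<le> card {s \<in> {0<..v}. \<bar>jump X s \<omega>\<bar> \<ge> L}"
    if "\<omega> \<in> space M" "q \<le> card {s \<in> {0<..u}. \<bar>jump X s \<omega>\<bar> \<ge> L}" for \<omega>
  proof -
    have "card {s \<in> {0<..u}. \<bar>jump X s \<omega>\<bar> \<ge> L} \<le> card {s \<in> {0<..v}. \<bar>jump X s \<omega>\<bar> \<ge> L}"
      using \<open>u \<le> v\<close> finite_large_jumps[OF assms(1) that(1) assms(2,4)]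
      by (intro card_mono) auto
    with that(2) show ?thesis by simp
  qed
  then show ?thesis
    using \<open>u \<le> v\<close>
    unfolding bad_event_def jump_deviation_event_def critical_jump_event_def many_jumps_event_def
    by fastforce
qed

text \<open>
  The critical window around the \<open>k\<close>-th threshold is \<open>[r - r / 2\<^sup>k, r - r / 2\<^sup>k\<^sup>+\<^sup>1]\<close>. As \<open>k\<close> grows, it
  increases to \<open>r\<close> without reaching it, whereas only finitely many jumps have size at least \<open>r / 2\<close>.
\<close>

lemma eventually_no_critical_jump:
  assumes X: "adapted_cadlag M F t X" and r: "r > 0" and \<omega>: "\<omega> \<in> space M"
  shows "\<forall>\<^sub>F k in sequentially. \<omega> \<notin> critical_jump_event M X (r / 2 ^ (k + 2)) (threshold r k) t"
proof -
  let ?c = "\<lambda>k. r / 2 ^ (k + 2)"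
  have low: "threshold r k - ?c k = r - 4 * ?c k" and up: "threshold r k + ?c k = r - 2 * ?c k" for k
    by (simp_all add: threshold_def field_simps)
  have "(\<lambda>k. r * ((1/2) ^ 2 * (1/2) ^ k)) \<longlonglongrightarrow> r * ((1/2) ^ 2 * 0)"
    by (intro tendsto_intros LIMSEQ_power_zero) simp
  then have c0: "?c \<longlonglongrightarrow> 0" by (simp add: power_add power_divide)
  have "(\<lambda>k. r - 4 * ?c k) \<longlonglongrightarrow> r - 4 * 0" by (intro tendsto_intros c0)
  then have low_lim: "(\<lambda>k. threshold r k - ?c k) \<longlonglongrightarrow> r" unfolding low by simp
  have cpos: "?c k > 0" for k using r by simp
  have fin: "finite {s \<in> {0<..t}. \<bar>jump X s \<omega>\<bar> \<ge> r / 2}"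
    using r by (intro finite_large_jumps[OF X \<omega>]) auto
  have "\<forall>\<^sub>F k in sequentially. \<not> (threshold r k - ?c k \<le> \<bar>jump X s \<omega>\<bar> \<and> \<bar>jump X s \<omega>\<bar> \<le> threshold r k + ?c k)" for s
  proof (cases "\<bar>jump X s \<omega>\<bar> < r")
    case True
    from order_tendstoD(1)[OF low_lim True] show ?thesis by eventually_elim simp
  next
    case False
    have "\<bar>jump X s \<omega>\<bar> > threshold r k + ?c k" for k
      unfolding up using False cpos[of k] by linarith
    then show ?thesis by (auto simp: not_le)
  qed
  then have "\<forall>\<^sub>F k in sequentially. \<forall>s\<in>{s \<in> {0<..t}. \<bar>jump X s \<omega>\<bar> \<ge> r / 2}.
      \<not> (threshold r k - ?c k \<le> \<bar>jump X s \<omega>\<bar> \<and> \<bar>jump X s \<omega>\<bar> \<le> threshold r k + ?c k)"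
    by (intro eventually_ball_finite[OF fin]) auto
  moreover have "\<forall>\<^sub>F k in sequentially. r / 2 < threshold r k - ?c k"
    using r by (intro order_tendstoD(1)[OF low_lim]) simp
  ultimately show ?thesis
    by eventually_elim (force simp: critical_jump_event_def)
qed

lemma eventually_not_many_jumps: "\<forall>\<^sub>F q in sequentially. \<omega> \<notin> many_jumps_event M X L q t"
  using eventually_gt_at_top[of "card {s \<in> {0<..t}. \<bar>jump X s \<omega>\<bar> \<ge> L}"]
  by eventually_elim (auto simp: many_jumps_event_def)

lemma left_lim_indicator_before:
  assumes "s > 0"
  shows "left_lim (\<lambda>u. if ennreal u < T then 1 else 0) s = (if ennreal s \<le> T then 1 else 0)"
proof -
  have "\<forall>\<^sub>F u in at_left s. (if ennreal u < T then 1 else 0) = (if ennreal s \<le> T then 1 else (0::real))"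
  proof (cases "ennreal s \<le> T")
    case True
    have "ennreal u < T" if "u < s" for u
      using ennreal_lessI[OF \<open>s > 0\<close> that] True by (rule less_le_trans)
    then show ?thesis
      using True unfolding eventually_at_left_field by (intro exI[of _ 0]) (use assms in auto)
  next
    case False
    then have "T < ennreal s" by simp
    then obtain a where a: "T = ennreal a" "0 \<le> a" by (cases T) auto
    then have "a < s" using \<open>T < ennreal s\<close> by (simp add: ennreal_less_iff)
    moreover have "\<not> ennreal u < T" if "a < u" for u
      using that a by (simp add: not_less ennreal_leI)
    ultimately show ?thesis
      using False unfolding eventually_at_left_field by (intro exI[of _ a]) auto
  qed
  then have "((\<lambda>u. if ennreal u < T then 1 else 0) \<longlongrightarrow> (if ennreal s \<le> T then 1 else (0::real))) (at_left s)"
    by (rule tendsto_eventually)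
  then show ?thesis
    unfolding left_lim_def by (intro tendsto_Lim) (simp_all add: trivial_limit_at_left_real)
qed

lemma infsum_le_nn_integral_count_space:
  fixes f :: "'b \<Rightarrow> ennreal"
  assumes "A \<subseteq> B"
  shows "infsum f A \<le> (\<integral>\<^sup>+ x. f x \<partial>count_space B)"
proof (rule infsum_le_finite_sums)
  show "f summable_on A" by (rule nonneg_summable_on_complete) simp
  fix K assume K: "finite K" "K \<subseteq> A"
  have "sum f K = (\<Sum>x\<in>K. f x * indicator K x)" by simp
  also have "\<dots> = (\<integral>\<^sup>+ x. f x * indicator K x \<partial>count_space B)"
    using K assms by (intro nn_integral_count_space'[symmetric]) auto
  also have "\<dots> \<le> (\<integral>\<^sup>+ x. f x \<partial>count_space B)"
    by (intro nn_integral_mono) (auto simp: indicator_def)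
  finally show "sum f K \<le> (\<integral>\<^sup>+ x. f x \<partial>count_space B)" .
qed

context usual_filtered_prob_space
begin

lemma critical_jump_event_in_F:
  assumes X: "adapted_cadlag M F t X" and u: "0 \<le> u" "u \<le> t" and "c < L"
  shows "critical_jump_event M X c L u \<in> sets (F (ennreal u))"
proof -
  have "closed {x::real. L - c \<le> \<bar>x\<bar> \<and> \<bar>x\<bar> \<le> L + c}"
    by (intro closed_Collect_conj closed_Collect_le continuous_intros)
  then show ?thesis
    using jump_in_closed_event[OF X order_refl u, of "{x. L - c \<le> \<bar>x\<bar> \<and> \<bar>x\<bar> \<le> L + c}"] \<open>c < L\<close>
    by (simp add: critical_jump_event_def)
qed

lemma many_jumps_event_in_F:
  assumes X: "adapted_cadlag M F t X" and u: "0 \<le> u" "u \<le> t" and L: "0 < L"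
  shows "many_jumps_event M X L q u \<in> sets (F (ennreal u))"
  unfolding many_jumps_event_def by (rule number_of_large_jumps_event[OF X L u])

context
  fixes t :: real and X :: "real \<Rightarrow> 'a \<Rightarrow> real" and Xn :: "nat \<Rightarrow> real \<Rightarrow> 'a \<Rightarrow> real"
  assumes t: "t > 0" and X: "adapted_cadlag M F t X"
    and Xn: "\<And>n. n \<ge> 1 \<Longrightarrow> adapted_cadlag M F t (Xn n)"
begin

lemma jump_deviation_event_in_F:
  assumes "0 \<le> u" "u \<le> t" "c > 0" "l \<ge> 1"
  shows "jump_deviation_event M X Xn c l u \<in> sets (F (ennreal u))"
proof -
  have closed: "closed {x::real. c \<le> \<bar>x\<bar>}" by (intro closed_Collect_le continuous_intros)
  have "{\<omega> \<in> space M. \<exists>s\<in>{0<..u}. jump (\<lambda>s \<omega>. Xn n s \<omega> - X s \<omega>) s \<omega> \<in> {x. c \<le> \<bar>x\<bar>}} \<in> sets (F (ennreal u))"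
    if "n \<ge> l" for n
    using assms that by (intro jump_in_closed_event[OF adapted_cadlag_diff[OF X Xn]] closed) auto
  then have "(\<Union>n\<in>{l..}. {\<omega> \<in> space M. \<exists>s\<in>{0<..u}. jump (\<lambda>s \<omega>. Xn n s \<omega> - X s \<omega>) s \<omega> \<in> {x. c \<le> \<bar>x\<bar>}})
      \<in> sets (F (ennreal u))"
    by (intro sets.countable_UN'') auto
  also have "(\<Union>n\<in>{l..}. {\<omega> \<in> space M. \<exists>s\<in>{0<..u}. jump (\<lambda>s \<omega>. Xn n s \<omega> - X s \<omega>) s \<omega> \<in> {x. c \<le> \<bar>x\<bar>}})
      = jump_deviation_event M X Xn c l u"
  proof (rule set_eqI)
    fix \<omega>
    have "(\<exists>s\<in>{0<..u}. jump (\<lambda>s \<omega>. Xn n s \<omega> - X s \<omega>) s \<omega> \<in> {x. c \<le> \<bar>x\<bar>}) \<longleftrightarrow>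
        (\<exists>s\<in>{0<..u}. c \<le> \<bar>jump (Xn n) s \<omega> - jump X s \<omega>\<bar>)"
      if "\<omega> \<in> space M" "n \<ge> l" for n
      using that assms by (intro bex_cong) (simp_all add: jump_diff[OF X Xn])
    then show "\<omega> \<in> (\<Union>n\<in>{l..}. {\<omega> \<in> space M. \<exists>s\<in>{0<..u}. jump (\<lambda>s \<omega>. Xn n s \<omega> - X s \<omega>) s \<omega> \<in> {x. c \<le> \<bar>x\<bar>}})
      \<longleftrightarrow> \<omega> \<in> jump_deviation_event M X Xn c l u"
      unfolding jump_deviation_event_def by fast
  qed
  finally show ?thesis .
qed

context
  fixes c L :: real and l q :: nat
  assumes c: "0 < c" "c < L" and l: "l \<ge> 1"
begin

lemma stopping_time_bad_event: "stopping_time F (hitting_time t (bad_event M X Xn c L l q))"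
proof (rule stopping_time_hitting_time[OF t])
  fix u assume "0 \<le> u" "u \<le> t"
  then show "bad_event M X Xn c L l q u \<in> sets (F (ennreal u))"
    unfolding bad_event_def using c l
    by (intro sets.Un jump_deviation_event_in_F critical_jump_event_in_F[OF X] many_jumps_event_in_F[OF X]) auto
next
  fix u v assume "0 \<le> u" "u \<le> v" "v \<le> t"
  then show "bad_event M X Xn c L l q u \<subseteq> bad_event M X Xn c L l q v"
    using c by (intro bad_event_mono[OF X]) auto
qed

lemma prob_bad_event_hitting_time_le:
  "measure M {\<omega> \<in> space M. hitting_time t (bad_event M X Xn c L l q) \<omega> \<le> ennreal t} \<le>
    measure M (jump_deviation_event M X Xn c l t) + measure M (critical_jump_event M X c L t)
      + measure M (many_jumps_event M X L q t)"
proof -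
  have D: "jump_deviation_event M X Xn c l t \<in> sets M"
    using jump_deviation_event_in_F[of t c l] sets_F_subset t c l by auto
  have C: "critical_jump_event M X c L t \<in> sets M"
    using critical_jump_event_in_F[OF X, of t c L] sets_F_subset t c by auto
  have N: "many_jumps_event M X L q t \<in> sets M"
    using many_jumps_event_in_F[OF X, of t L q] sets_F_subset t c by auto
  have "bad_event M X Xn c L l q u \<subseteq> bad_event M X Xn c L l q v"
    if "0 \<le> u" "u \<le> v" "v \<le> t" for u v
    using that c by (intro bad_event_mono[OF X]) auto
  then have "{\<omega> \<in> space M. hitting_time t (bad_event M X Xn c L l q) \<omega> \<le> ennreal t} \<subseteq>
      bad_event M X Xn c L l q t"
    by (auto intro: in_if_hitting_time_le)
  then have "measure M {\<omega> \<in> space M. hitting_time t (bad_event M X Xn c L l q) \<omega> \<le> ennreal t} \<le>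
      measure M (bad_event M X Xn c L l q t)"
    using D C N by (intro finite_measure_mono) (auto simp: bad_event_def)
  also have "\<dots> \<le> measure M (jump_deviation_event M X Xn c l t \<union> critical_jump_event M X c L t)
      + measure M (many_jumps_event M X L q t)"
    unfolding bad_event_def using D C N by (intro measure_Un_le) auto
  also have "measure M (jump_deviation_event M X Xn c l t \<union> critical_jump_event M X c L t) \<le>
      measure M (jump_deviation_event M X Xn c l t) + measure M (critical_jump_event M X c L t)"
    using D C by (rule measure_Un_le)
  finally show ?thesis by simp
qed

text \<open>
  A deviation of less than \<open>c\<close> cannot carry a jump across the threshold when the jump of \<open>X\<close> is
  farther than \<open>c\<close> from it.
\<close>

lemma large_jump_iff_before_bad_event:
  assumes "\<omega> \<in> space M" "s \<in> {0<..t}" "ennreal s < hitting_time t (bad_event M X Xn c L l q) \<omega>" "n \<ge> l"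
  shows "\<bar>jump (Xn n) s \<omega>\<bar> > L \<longleftrightarrow> \<bar>jump X s \<omega>\<bar> > L"
proof -
  have "\<omega> \<notin> bad_event M X Xn c L l q s"
    using assms by (intro notin_before_hitting_time) auto
  then have "\<omega> \<notin> jump_deviation_event M X Xn c l s" "\<omega> \<notin> critical_jump_event M X c L s"
    by (auto simp: bad_event_def)
  moreover have "s \<in> {0<..s}" using assms(2) by auto
  ultimately have "\<bar>jump (Xn n) s \<omega> - jump X s \<omega>\<bar> < c" "\<not> (L - c \<le> \<bar>jump X s \<omega>\<bar> \<and> \<bar>jump X s \<omega>\<bar> \<le> L + c)"
    using assms(1,4) unfolding jump_deviation_event_def critical_jump_event_def mem_Collect_eq
    by (metis not_le, blast)
  then show ?thesis by linarith
qed

text \<open>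
  The last of these jump times is itself before the hitting time, and at that time all of them have
  been counted.
\<close>

lemma card_large_jumps_before_bad_event:
  assumes \<omega>: "\<omega> \<in> space M" and "q \<ge> 1"
  shows "card {s \<in> {0<..t}. ennreal s < hitting_time t (bad_event M X Xn c L l q) \<omega> \<and> \<bar>jump X s \<omega>\<bar> \<ge> L} < q"
    (is "card ?S < q")
proof (cases "?S = {}")
  case True
  then have "card ?S = 0" by (simp only: card.empty)
  with \<open>q \<ge> 1\<close> show ?thesis by linarith
next
  case False
  have "finite {s \<in> {0<..t}. \<bar>jump X s \<omega>\<bar> \<ge> L}"
    using c by (intro finite_large_jumps[OF X \<omega>]) auto
  then have fin: "finite ?S" by (rule finite_subset[rotated]) auto
  define m where "m = Max ?S"
  have m: "m \<in> ?S" unfolding m_def using fin False by (rule Max_in)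
  have "\<omega> \<notin> bad_event M X Xn c L l q m"
    using m by (intro notin_before_hitting_time) auto
  then have "card {s \<in> {0<..m}. \<bar>jump X s \<omega>\<bar> \<ge> L} < q"
    using \<omega> by (auto simp: bad_event_def many_jumps_event_def not_le)
  moreover have "card ?S \<le> card {s \<in> {0<..m}. \<bar>jump X s \<omega>\<bar> \<ge> L}"
  proof (rule card_mono)
    show "finite {s \<in> {0<..m}. \<bar>jump X s \<omega>\<bar> \<ge> L}"
      using c m by (intro finite_large_jumps[OF X \<omega>]) auto
    show "?S \<subseteq> {s \<in> {0<..m}. \<bar>jump X s \<omega>\<bar> \<ge> L}"
      using Max_ge[OF fin] unfolding m_def by auto
  qed
  ultimately show ?thesis by simp
qed

end

lemma AE_eventually_no_jump_deviation:
  assumes qv: "\<And>n. n \<ge> 1 \<Longrightarrow> has_quadratic_variation M t (\<lambda>s \<omega>. Xn n s \<omega> - X s \<omega>) (Q n)"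
    and Q: "AE \<omega> in M. (\<lambda>n. Q n t \<omega>) \<longlonglongrightarrow> 0" and "c > 0"
  shows "AE \<omega> in M. \<forall>\<^sub>F l in sequentially. \<omega> \<notin> jump_deviation_event M X Xn c l t"
proof -
  have "AE \<omega> in M. \<forall>s\<in>{0<..t}. (jump (\<lambda>s \<omega>. Xn n s \<omega> - X s \<omega>) s \<omega>)\<^sup>2 \<le> Q n t \<omega>" if n: "n \<ge> 1" for n
  proof (rule AE_jump_squared_le_quadratic_variation[OF qv[OF n] t])
    note d = adapted_cadlag_diff[OF X Xn[OF n]]
    show "(\<lambda>\<omega>. Xn n s \<omega> - X s \<omega>) \<in> borel_measurable M" if "s \<in> {0..t}" for s
      using d that unfolding adapted_cadlag_def adapted_on_def
      by (intro borel_measurable_F_imp_M[of _ "ennreal s"]) blast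
    show "cadlag_on t (\<lambda>s. Xn n s \<omega> - X s \<omega>)" if "\<omega> \<in> space M" for \<omega>
      using d that unfolding adapted_cadlag_def by blast
  qed
  then have "AE \<omega> in M. n \<ge> 1 \<longrightarrow> (\<forall>s\<in>{0<..t}. (jump (\<lambda>s \<omega>. Xn n s \<omega> - X s \<omega>) s \<omega>)\<^sup>2 \<le> Q n t \<omega>)" for n
    by (cases "n \<ge> 1") auto
  then have "AE \<omega> in M. \<forall>n. n \<ge> 1 \<longrightarrow> (\<forall>s\<in>{0<..t}. (jump (\<lambda>s \<omega>. Xn n s \<omega> - X s \<omega>) s \<omega>)\<^sup>2 \<le> Q n t \<omega>)"
    by (simp only: AE_all_countable) blast
  with Q AE_space show ?thesis
  proof eventually_elim
    case (elim \<omega>)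
    have "\<forall>\<^sub>F n in sequentially. Q n t \<omega> < c\<^sup>2"
      using elim(1) \<open>c > 0\<close> by (intro order_tendstoD(2)) auto
    then obtain n0 where n0: "\<And>n. n \<ge> n0 \<Longrightarrow> Q n t \<omega> < c\<^sup>2"
      by (auto simp: eventually_sequentially)
    have "\<omega> \<notin> jump_deviation_event M X Xn c l t" if l: "l \<ge> max 1 n0" for l
    proof
      assume "\<omega> \<in> jump_deviation_event M X Xn c l t"
      then obtain n s where ns: "n \<ge> l" "s \<in> {0<..t}" "c \<le> \<bar>jump (Xn n) s \<omega> - jump X s \<omega>\<bar>"
        by (auto simp: jump_deviation_event_def)
      then have n: "n \<ge> 1" "n \<ge> n0" using l by auto
      have "c\<^sup>2 \<le> \<bar>jump (Xn n) s \<omega> - jump X s \<omega>\<bar>\<^sup>2"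
        using ns \<open>c > 0\<close> by (intro power_mono) auto
      also have "\<dots> = (jump (\<lambda>s \<omega>. Xn n s \<omega> - X s \<omega>) s \<omega>)\<^sup>2"
        using ns elim(2) by (simp add: jump_diff[OF X Xn[OF n(1)]])
      also have "\<dots> \<le> Q n t \<omega>" using elim(3) ns n by blast
      also have "\<dots> < c\<^sup>2" by (rule n0[OF n(2)])
      finally show False by simp
    qed
    then show ?case by (rule eventually_sequentiallyI)
  qed
qed

end

end

section \<open>Localisation along the thresholds\<close>

theorem lemma5p3:
  fixes M :: "'a measure" and F :: "ennreal \<Rightarrow> 'a measure" and t :: real
    and X :: "real \<Rightarrow> 'a \<Rightarrow> real" and Xn :: "nat \<Rightarrow> real \<Rightarrow> 'a \<Rightarrow> real"
    and \<nu> :: "'a \<Rightarrow> (real \<times> real) measure" and \<nu>n :: "nat \<Rightarrow> 'a \<Rightarrow> (real \<times> real) measure"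
    and Q :: "nat \<Rightarrow> real \<Rightarrow> 'a \<Rightarrow> real"
  assumes "usual_filtered_prob_space M F"
    and "t > 0"
    and "adapted_cadlag M F t X"
    and "\<And>n. n \<ge> 1 \<Longrightarrow> adapted_cadlag M F t (Xn n)"
    and "jump_compensator M F t X \<nu>"
    and "\<And>n. n \<ge> 1 \<Longrightarrow> jump_compensator M F t (Xn n) (\<nu>n n)"
    and "\<And>n. n \<ge> 1 \<Longrightarrow> has_quadratic_variation M t (\<lambda>s \<omega>. Xn n s \<omega> - X s \<omega>) (Q n)"
    and "AE \<omega> in M. (\<lambda>n. Q n t \<omega>) \<longlonglongrightarrow> 0"
  shows "\<forall>r>0. \<exists>\<theta> :: nat \<Rightarrow> nat \<Rightarrow> nat \<Rightarrow> nat \<Rightarrow> 'a \<Rightarrow> ennreal.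
    (\<forall>q\<ge>1. \<forall>k\<ge>1. \<forall>l\<ge>1. \<forall>n\<ge>1. stopping_time F (\<theta> q k l n)) \<and>
    (\<forall>q\<ge>1. \<forall>k\<ge>1. \<forall>l\<ge>1. \<forall>n\<ge>1. AE \<omega> in M.
       {s. (s, \<omega>) \<in> atom_set M t (\<nu>n n) \<and> ennreal s < \<theta> q k l n \<omega> \<and> \<bar>jump (Xn n) s \<omega>\<bar> > threshold r k} =
       {s. (s, \<omega>) \<in> atom_set M t \<nu> \<and> ennreal s < \<theta> q k l n \<omega> \<and> \<bar>jump X s \<omega>\<bar> > threshold r k}) \<and>
    (\<forall>\<epsilon>>0. \<exists>k0\<ge>1. \<forall>k\<ge>k0. \<exists>l0\<ge>1. \<forall>l\<ge>l0. \<exists>q0\<ge>1. \<forall>q\<ge>q0.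
       (SUP n\<in>{l..}. measure M {\<omega> \<in> space M. \<theta> q k l n \<omega> \<le> ennreal t}) < \<epsilon>) \<and>
    (\<forall>q\<ge>1. \<forall>k\<ge>1. \<forall>l\<ge>1. AE \<omega> in M.
       (\<Sum>\<^sub>\<infinity>s\<in>{0<..t}. SUP n\<in>{l..}.
          ennreal (left_lim (\<lambda>u. if ennreal u < \<theta> q k l n \<omega> then 1 else 0) s) *
          (emeasure (\<nu>n n \<omega>) ({s} \<times> {x. \<bar>x\<bar> > threshold r k}) +
           emeasure (\<nu> \<omega>) ({s} \<times> {x. \<bar>x\<bar> > threshold r k}))) < \<infinity>)"
proof (intro allI impI)
  fix r :: real assume r: "r > 0"
  interpret usual_filtered_prob_space M F by fact
  note t = assms(2) and X = assms(3) and Xn = assms(4)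
  have t0: "0 \<le> t" using t by simp
  define L where "L = threshold r"
  \<comment> \<open>the half-width for which \<open>L k - c k\<close> and \<open>L k + c k\<close> are \<open>r - r / 2\<^sup>k\<close> and \<open>r - r / 2\<^sup>k\<^sup>+\<^sup>1\<close>\<close>
  define c where "c k = r / 2 ^ (k + 2)" for k :: nat
  have c_pos: "0 < c k" for k using r by (simp add: c_def)
  have c_less: "c k < L k" if "k \<ge> 1" for k
  proof -
    have "(2::real) ^ 1 \<le> 2 ^ k" using that by (intro power_increasing) auto
    then show ?thesis using r by (simp add: c_def L_def threshold_def field_simps)
  qed
  have L_pos: "0 < L k" if "k \<ge> 1" for k using c_pos[of k] c_less[OF that] by simp
  define T where "T q k l = hitting_time t (bad_event M X Xn (c k) (L k) l q)" for q k l
  \<comment> \<open>For \<open>n < l\<close> the smallness of the probability and the sum ask for nothing, whereas the jump sets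
    have to agree on \<open>[0, \<theta>)\<close>; the value \<open>0\<close> makes that interval empty.\<close>
  define \<theta> :: "nat \<Rightarrow> nat \<Rightarrow> nat \<Rightarrow> nat \<Rightarrow> 'a \<Rightarrow> ennreal"
    where "\<theta> q k l n = (if l \<le> n then T q k l else (\<lambda>_. 0))" for q k l n
  have T_stop: "stopping_time F (T q k l)" if "k \<ge> 1" "l \<ge> 1" for q k l
    unfolding T_def by (rule stopping_time_bad_event[OF t X Xn c_pos c_less[OF that(1)] that(2)])

  have stop: "stopping_time F (\<theta> q k l n)" if "k \<ge> 1" "l \<ge> 1" for q k l n
    using T_stop[OF that] by (simp add: \<theta>_def stopping_time_const)

  have same_jumps: "AE \<omega> in M.
       {s. (s, \<omega>) \<in> atom_set M t (\<nu>n n) \<and> ennreal s < \<theta> q k l n \<omega> \<and> \<bar>jump (Xn n) s \<omega>\<bar> > L k} =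
       {s. (s, \<omega>) \<in> atom_set M t \<nu> \<and> ennreal s < \<theta> q k l n \<omega> \<and> \<bar>jump X s \<omega>\<bar> > L k}"
    if k: "k \<ge> 1" and l: "l \<ge> 1" and n: "n \<ge> 1" for q k l n
  proof (cases "l \<le> n")
    case False
    then show ?thesis by (simp add: \<theta>_def)
  next
    case True
    have thin: "thin_exhausted_by_predictable M F (atom_set M t \<nu>)"
      "thin_exhausted_by_predictable M F (atom_set M t (\<nu>n n))"
      using assms(5) assms(6)[OF n] unfolding jump_compensator_def by blast+
    have "AE \<omega> in M. \<forall>s. (s, \<omega>) \<in> atom_set M t \<nu> \<longrightarrow> jump (Xn n) s \<omega> \<noteq> 0 \<longrightarrow> (s, \<omega>) \<in> atom_set M t (\<nu>n n)"
      by (rule AE_no_jump_off_atoms[OF Xn[OF n] t0 assms(6)[OF n] atom_set_predictable[OF assms(5) t0] thin(1)])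
    moreover have "AE \<omega> in M. \<forall>s. (s, \<omega>) \<in> atom_set M t (\<nu>n n) \<longrightarrow> jump X s \<omega> \<noteq> 0 \<longrightarrow> (s, \<omega>) \<in> atom_set M t \<nu>"
      by (rule AE_no_jump_off_atoms[OF X t0 assms(5) atom_set_predictable[OF assms(6)[OF n] t0] thin(2)])
    ultimately show ?thesis
      using AE_space
    proof eventually_elim
      case (elim \<omega>)
      have iff: "\<bar>jump (Xn n) s \<omega>\<bar> > L k \<longleftrightarrow> \<bar>jump X s \<omega>\<bar> > L k"
        if "s \<in> {0..t}" "ennreal s < T q k l \<omega>" for s
      proof (cases "s = 0")
        case True
        then show ?thesis using L_pos[OF k] by (simp add: jump_def)
      next
        case False
        with that show ?thesis
          unfolding T_def using \<open>l \<le> n\<close>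
          by (intro large_jump_iff_before_bad_event[OF t X Xn c_pos c_less[OF k] l elim(3)]) auto
      qed
      have "jump Y s \<omega> \<noteq> 0" if "\<bar>jump Y s \<omega>\<bar> > L k" for s and Y :: "real \<Rightarrow> 'a \<Rightarrow> real"
        using that L_pos[OF k] by auto
      moreover have "s \<in> {0..t}" if "(s, \<omega>) \<in> atom_set M t (\<nu>n n) \<or> (s, \<omega>) \<in> atom_set M t \<nu>" for s
        using that by (auto simp: atom_set_def)
      ultimately show ?case
        using elim(1,2) iff True unfolding \<theta>_def by (simp only: if_True) blast
    qed
  qed

  have prob_small: "\<exists>k0\<ge>1. \<forall>k\<ge>k0. \<exists>l0\<ge>1. \<forall>l\<ge>l0. \<exists>q0\<ge>1. \<forall>q\<ge>q0.
       (SUP n\<in>{l..}. measure M {\<omega> \<in> space M. \<theta> q k l n \<omega> \<le> ennreal t}) < \<epsilon>" if "\<epsilon> > 0" for \<epsilon> :: real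
  proof -
    have \<epsilon>: "\<epsilon> / 3 > 0" using that by simp
    have "\<exists>k0\<ge>1. \<forall>k\<ge>k0. measure M (critical_jump_event M X (c k) (L k) t) < \<epsilon> / 3"
    proof (rule prob_tendsto_zero_if_AE_eventually_notin[OF _ _ \<epsilon>])
      show "critical_jump_event M X (c k) (L k) t \<in> sets M" if "k \<ge> 1" for k
        by (rule subsetD[OF sets_F_subset critical_jump_event_in_F[OF X t0 order_refl c_less[OF that]]])
      show "AE \<omega> in M. \<forall>\<^sub>F k in sequentially. \<omega> \<notin> critical_jump_event M X (c k) (L k) t"
        unfolding c_def L_def using eventually_no_critical_jump[OF X r] by (intro AE_I2) auto
    qed
    then obtain k0 where k0: "k0 \<ge> 1"
      "\<And>k. k \<ge> k0 \<Longrightarrow> measure M (critical_jump_event M X (c k) (L k) t) < \<epsilon> / 3" by blast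
    have "\<exists>l0\<ge>1. \<forall>l\<ge>l0. measure M (jump_deviation_event M X Xn (c k) l t) < \<epsilon> / 3" for k
    proof (rule prob_tendsto_zero_if_AE_eventually_notin[OF _ _ \<epsilon>])
      show "jump_deviation_event M X Xn (c k) l t \<in> sets M" if "l \<ge> 1" for l
        by (rule subsetD[OF sets_F_subset jump_deviation_event_in_F[OF t X Xn t0 order_refl c_pos that]])
      show "AE \<omega> in M. \<forall>\<^sub>F l in sequentially. \<omega> \<notin> jump_deviation_event M X Xn (c k) l t"
        by (rule AE_eventually_no_jump_deviation[OF t X Xn assms(7,8) c_pos])
    qed
    then obtain l0 where l0: "\<And>k. l0 k \<ge> 1"
      "\<And>k l. l \<ge> l0 k \<Longrightarrow> measure M (jump_deviation_event M X Xn (c k) l t) < \<epsilon> / 3" by metis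
    have "\<exists>q0\<ge>1. \<forall>q\<ge>q0. measure M (many_jumps_event M X (L k) q t) < \<epsilon> / 3" if "k \<ge> 1" for k
    proof (rule prob_tendsto_zero_if_AE_eventually_notin[OF _ _ \<epsilon>])
      show "many_jumps_event M X (L k) q t \<in> sets M" for q
        by (rule subsetD[OF sets_F_subset many_jumps_event_in_F[OF X t0 order_refl L_pos[OF that]]])
      show "AE \<omega> in M. \<forall>\<^sub>F q in sequentially. \<omega> \<notin> many_jumps_event M X (L k) q t"
        by (intro AE_I2 eventually_not_many_jumps)
    qed
    then obtain q0 where q0: "\<And>k. k \<ge> 1 \<Longrightarrow> q0 k \<ge> 1"
      "\<And>k q. k \<ge> 1 \<Longrightarrow> q \<ge> q0 k \<Longrightarrow> measure M (many_jumps_event M X (L k) q t) < \<epsilon> / 3" by metis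
    have "(SUP n\<in>{l..}. measure M {\<omega> \<in> space M. \<theta> q k l n \<omega> \<le> ennreal t}) < \<epsilon>"
      if k: "k \<ge> k0" and l: "l \<ge> l0 k" and q: "q \<ge> q0 k" for q k l
    proof -
      have k1: "k \<ge> 1" using k0(1) k by linarith
      have l1: "l \<ge> 1" using l0(1)[of k] l by linarith
      have "(SUP n\<in>{l..}. measure M {\<omega> \<in> space M. \<theta> q k l n \<omega> \<le> ennreal t}) =
          (SUP n\<in>{l..}. measure M {\<omega> \<in> space M. T q k l \<omega> \<le> ennreal t})"
        by (intro SUP_cong) (auto simp: \<theta>_def)
      also have "\<dots> = measure M {\<omega> \<in> space M. T q k l \<omega> \<le> ennreal t}" by simp
      also have "\<dots> \<le> measure M (jump_deviation_event M X Xn (c k) l t) +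
          measure M (critical_jump_event M X (c k) (L k) t) + measure M (many_jumps_event M X (L k) q t)"
        unfolding T_def by (rule prob_bad_event_hitting_time_le[OF t X Xn c_pos c_less[OF k1] l1])
      also have "\<dots> < \<epsilon>"
        using k0(2)[OF k] l0(2)[OF l] q0(2)[OF k1 q] by linarith
      finally show ?thesis .
    qed
    moreover have "q0 k \<ge> 1" if "k \<ge> k0" for k
      using q0(1)[of k] k0(1) that by linarith
    ultimately have "\<exists>q0\<ge>1. \<forall>q\<ge>q0. (SUP n\<in>{l..}. measure M {\<omega> \<in> space M. \<theta> q k l n \<omega> \<le> ennreal t}) < \<epsilon>"
      if "k \<ge> k0" "l \<ge> l0 k" for k l
      using that by blast
    then have "\<exists>l0\<ge>1. \<forall>l\<ge>l0. \<exists>q0\<ge>1. \<forall>q\<ge>q0.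
        (SUP n\<in>{l..}. measure M {\<omega> \<in> space M. \<theta> q k l n \<omega> \<le> ennreal t}) < \<epsilon>" if "k \<ge> k0" for k
      using l0(1)[of k] that by blast
    with k0(1) show ?thesis by blast
  qed

  have sum_finite: "AE \<omega> in M. (\<Sum>\<^sub>\<infinity>s\<in>{0<..t}. SUP n\<in>{l..}.
          ennreal (left_lim (\<lambda>u. if ennreal u < \<theta> q k l n \<omega> then 1 else 0) s) *
          (emeasure (\<nu>n n \<omega>) ({s} \<times> {x. \<bar>x\<bar> > L k}) + emeasure (\<nu> \<omega>) ({s} \<times> {x. \<bar>x\<bar> > L k}))) < \<infinity>"
    if q: "q \<ge> 1" and k: "k \<ge> 1" and l: "l \<ge> 1" for q k l
  proof -
    let ?B = "{x. \<bar>x\<bar> > L k}"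
    \<comment> \<open>The indices \<open>i < l\<close> are filled up with \<open>X\<close> itself, so that one supremum covers both \<open>\<nu>\<close> and
      all \<open>\<nu>n n\<close> with \<open>n \<ge> l\<close>.\<close>
    define Z where "Z i = (if i < l then X else Xn i)" for i
    define N where "N i = (if i < l then \<nu> else \<nu>n i)" for i
    let ?J = "\<lambda>\<omega>. {s \<in> {0<..t}. ennreal s < T q k l \<omega> \<and> \<bar>jump X s \<omega>\<bar> \<ge> L k}"
    \<comment> \<open>The comparison of jumps holds strictly before \<open>T\<close>, while the left limit of the indicator still
      counts the time \<open>T\<close>; this costs one further time.\<close>
    let ?S = "\<lambda>\<omega>. insert (enn2real (T q k l \<omega>)) (?J \<omega>)"
    have "AE \<omega> in M. (\<integral>\<^sup>+ u. indicator {u. ennreal u \<le> T q k l \<omega>} u *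
        (SUP i. emeasure (N i \<omega>) ({u} \<times> ?B)) \<partial>count_space {0..t}) < \<infinity>"
    proof (rule AE_sum_SUP_atoms_finite[where Z = Z and S = ?S and q = q])
      show "adapted_cadlag M F t (Z i)" for i using X Xn l by (auto simp: Z_def)
      show "jump_compensator M F t (Z i) (N i)" for i using assms(5,6) l by (auto simp: Z_def N_def)
      show "stopping_time F (T q k l)" by (rule T_stop[OF k l])
      show "?B \<in> sets borel" by measurable
      show "0 \<notin> ?B" using L_pos[OF k] by simp
      show "0 \<le> t" by (rule t0)
    next
      fix i \<omega> u
      assume \<omega>: "\<omega> \<in> space M" and u: "u \<in> {0..t}" "ennreal u \<le> T q k l \<omega>" and j: "jump (Z i) u \<omega> \<in> ?B"
      have "u \<noteq> 0" using j L_pos[OF k] by (auto simp: jump_def)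
      show "u \<in> ?S \<omega>"
      proof (cases "ennreal u = T q k l \<omega>")
        case True
        then have "u = enn2real (T q k l \<omega>)" using u by (metis enn2real_ennreal atLeastAtMost_iff)
        then show ?thesis by simp
      next
        case False
        then have less: "ennreal u < T q k l \<omega>" using u by simp
        have "\<bar>jump X u \<omega>\<bar> > L k"
        proof (cases "i < l")
          case True
          then show ?thesis using j by (simp add: Z_def)
        next
          case False
          then have "\<bar>jump (Xn i) u \<omega>\<bar> > L k" using j by (simp add: Z_def)
          then show ?thesis
            using large_jump_iff_before_bad_event[OF t X Xn c_pos c_less[OF k] l \<omega> _ less[unfolded T_def], of i]
              u \<open>u \<noteq> 0\<close> False by simp
        qed
        then show ?thesis using u less \<open>u \<noteq> 0\<close> by auto
      qed
    next
      fix \<omega> assume \<omega>: "\<omega> \<in> space M"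
      have "finite {s \<in> {0<..t}. \<bar>jump X s \<omega>\<bar> \<ge> L k}"
        using L_pos[OF k] by (intro finite_large_jumps[OF X \<omega>]) auto
      then have "finite (?J \<omega>)" by (rule finite_subset[rotated]) auto
      moreover have "card (?J \<omega>) < q"
        unfolding T_def by (rule card_large_jumps_before_bad_event[OF t X Xn c_pos c_less[OF k] l \<omega> q])
      ultimately show "finite (?S \<omega>) \<and> card (?S \<omega>) \<le> q"
        using card_insert_le_m1[of q "?J \<omega>" "enn2real (T q k l \<omega>)"] by (auto simp: card_insert_if)
    qed
    then show ?thesis
    proof (rule AE_mp, intro AE_I2 impI)
      fix \<omega>
      define h where "h u = indicator {u. ennreal u \<le> T q k l \<omega>} u * (SUP i. emeasure (N i \<omega>) ({u} \<times> ?B))" for u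
      assume fin: "(\<integral>\<^sup>+ u. indicator {u. ennreal u \<le> T q k l \<omega>} u *
        (SUP i. emeasure (N i \<omega>) ({u} \<times> ?B)) \<partial>count_space {0..t}) < \<infinity>"
      let ?f = "\<lambda>s. SUP n\<in>{l..}. ennreal (left_lim (\<lambda>u. if ennreal u < \<theta> q k l n \<omega> then 1 else 0) s) *
          (emeasure (\<nu>n n \<omega>) ({s} \<times> ?B) + emeasure (\<nu> \<omega>) ({s} \<times> ?B))"
      have f_le: "?f s \<le> 2 * h s" if s: "s \<in> {0<..t}" for s
      proof (rule SUP_least)
        fix n assume n: "n \<in> {l..}"
        have "N n = \<nu>n n" "N 0 = \<nu>" using n l by (auto simp: N_def)
        then have le: "emeasure (\<nu>n n \<omega>) ({s} \<times> ?B) + emeasure (\<nu> \<omega>) ({s} \<times> ?B) \<le>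
            2 * (SUP i. emeasure (N i \<omega>) ({s} \<times> ?B))"
          unfolding mult_2 by (intro add_mono) (metis SUP_upper UNIV_I)+
        show "ennreal (left_lim (\<lambda>u. if ennreal u < \<theta> q k l n \<omega> then 1 else 0) s) *
          (emeasure (\<nu>n n \<omega>) ({s} \<times> ?B) + emeasure (\<nu> \<omega>) ({s} \<times> ?B)) \<le> 2 * h s"
          using left_lim_indicator_before[of s "\<theta> q k l n \<omega>"] s n le
          by (auto simp: \<theta>_def h_def indicator_def)
      qed
      have "infsum ?f {0<..t} \<le> infsum (\<lambda>s. 2 * h s) {0<..t}"
        by (intro infsum_mono nonneg_summable_on_complete f_le) auto
      also have "\<dots> \<le> (\<integral>\<^sup>+ s. 2 * h s \<partial>count_space {0..t})"
        by (rule infsum_le_nn_integral_count_space) auto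
      also have "\<dots> = 2 * (\<integral>\<^sup>+ s. h s \<partial>count_space {0..t})"
        by (rule nn_integral_cmult) simp
      also have "\<dots> < \<infinity>"
        using fin unfolding h_def by (auto simp: ennreal_mult_less_top)
      finally show "infsum ?f {0<..t} < \<infinity>" .
    qed
  qed

  show "\<exists>\<theta> :: nat \<Rightarrow> nat \<Rightarrow> nat \<Rightarrow> nat \<Rightarrow> 'a \<Rightarrow> ennreal.
    (\<forall>q\<ge>1. \<forall>k\<ge>1. \<forall>l\<ge>1. \<forall>n\<ge>1. stopping_time F (\<theta> q k l n)) \<and>
    (\<forall>q\<ge>1. \<forall>k\<ge>1. \<forall>l\<ge>1. \<forall>n\<ge>1. AE \<omega> in M.
       {s. (s, \<omega>) \<in> atom_set M t (\<nu>n n) \<and> ennreal s < \<theta> q k l n \<omega> \<and> \<bar>jump (Xn n) s \<omega>\<bar> > threshold r k} =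
       {s. (s, \<omega>) \<in> atom_set M t \<nu> \<and> ennreal s < \<theta> q k l n \<omega> \<and> \<bar>jump X s \<omega>\<bar> > threshold r k}) \<and>
    (\<forall>\<epsilon>>0. \<exists>k0\<ge>1. \<forall>k\<ge>k0. \<exists>l0\<ge>1. \<forall>l\<ge>l0. \<exists>q0\<ge>1. \<forall>q\<ge>q0.
       (SUP n\<in>{l..}. measure M {\<omega> \<in> space M. \<theta> q k l n \<omega> \<le> ennreal t}) < \<epsilon>) \<and>
    (\<forall>q\<ge>1. \<forall>k\<ge>1. \<forall>l\<ge>1. AE \<omega> in M.
       (\<Sum>\<^sub>\<infinity>s\<in>{0<..t}. SUP n\<in>{l..}.
          ennreal (left_lim (\<lambda>u. if ennreal u < \<theta> q k l n \<omega> then 1 else 0) s) *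
          (emeasure (\<nu>n n \<omega>) ({s} \<times> {x. \<bar>x\<bar> > threshold r k}) +
           emeasure (\<nu> \<omega>) ({s} \<times> {x. \<bar>x\<bar> > threshold r k}))) < \<infinity>)"
    unfolding L_def[symmetric]
    by (rule exI[of _ \<theta>], intro conjI allI impI stop same_jumps prob_small sum_finite)
qed

end
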